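(* Let $\mathcal{B}$ be a decorated bicategory. Let $C$ be a double category. If $H^*C=\mathcal{B}$, then $\ell C\leq \ell\mathcal{B}$, where $\ell$ denotes length.
   Context: Double categories. A double category $C$ (possibly weak in the horizontal direction) consists of a category $C_0$ (objects and vertical morphisms), a category $C_1$ (horizontal morphisms and squares; composition in $C_1$ is vertical composition, written $\bullet$), functors $s,t:C_1\to C_0$ (left and right edge), a horizontal identity functor $i:C_0\to C_1$ (its value on a vertical morphism $f$ is the square $i_f$), a horizontal composition functor $*:C_1\times_{C_0}C_1\to C_1$ (the composite of $\Phi$ followed on its right by $\Psi$ is written $\Psi*\Phi$), and invertible globular associator and left/right unitor natural transformations satisfying the usual coherence axioms. A square is globular if its left and right edges are identity vertical morphisms. $HC$ denotes the horizontal bicategory of $C$: 0-cells, 1-cells, 2-cells are the objects, horizontal morphisms, globular squares of $C$. A decorated bicategory $\mathcal{B}$ is a bicategory (also written $\mathcal{B}$) together with a category $\mathcal{B}^*$ (the decoration) whose objects are the 0-cells of $\mathcal{B}$. For a double category $C$, $H^*C$ is $HC$ decorated by $C_0$. $\gamma C$ denotes the sub-double category of $C$ with the same objects, vertical and horizontal morphisms whose squares are those obtained by vertical and horizontal compositions from globular squares and squares $i_f$; $C$ is globularly generated if $\gamma C=C$. Length. For a globularly generated double category $C$, let $H^1_C$ be the set of squares that are horizontal compositions (with any parenthesization) of globular squares and squares $i_f$; let $V^k_C$ be the subcategory of $C_1$ generated by $H^k_C$, and $H^{k+1}_C$ the set of horizontal compositions of squares in $V^k_C$, $k\ge1$. The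 length $\ell C\in\mathbb{N}\cup\{\infty\}$ is the minimal $k\ge 1$ with $V^k_C=C_1$ ($\infty$ if there is none). For a general double category $C$, $\ell C:=\ell\gamma C$. For a decorated bicategory $\mathcal{B}$, $\ell\mathcal{B}:=\ell Q_{\mathcal{B}}$. The free globularly generated double category $Q_{\mathcal{B}}$. Let $\mathbb{G}$ be the collection of formal squares of two kinds: for every 2-cell $\varphi:\alpha\Rightarrow\beta$ of $\mathcal{B}$ with $\alpha,\beta:a\to b$, a square $\varphi$ with top $\alpha$, bottom $\beta$, left edge $id_a$, right edge $id_b$; and for every morphism $f:a\to b$ of $\mathcal{B}^*$, a square $i_f$ with top the identity 1-cell $i_a$, bottom $i_b$, left and right edges $f$. The squares $i_{id_a}$ and $id_{i_a}$ are regarded as equal. Form all formal expressions obtained from $\mathbb{G}$ by formal vertical composition $\Psi\bullet\Phi$ (when the bottom of $\Phi$ equals the top of $\Psi$; left and right edges compose in $\mathcal{B}^*$) and formal parenthesized horizontal composition $\Psi*\Phi$ (when the right edge of $\Phi$ equals the left edge of $\Psi$; tops and bottoms compose as 1-cells of $\mathcal{B}$). Then $Q_{\mathcal{B}}$ has $\mathcal{B}^*$ as category of objects, the 1-cells of $\mathcal{B}$ (with their composition and identities) as horizontal morphisms, and as squares the expressions modulo the smallest equivalence relation compatible with $\bullet$ and $*$ such that: $\bullet$ is associative and the identity 2-cell $id_\alpha$ is a vertical identity at $\alpha$; (1) $(\Psi_2\bullet\Psi_1)*(\Phi_2\bullet\Phi_1)\sim(\Psi_2*\Phi_2)\bullet(\Psi_1*\Phi_1)$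 whenever both sides make sense; (2) for vertically composable 2-cells of $\mathcal{B}$ the formal composite $\psi\bullet\varphi$ is identified with their vertical composite in $\mathcal{B}$, and $i_g\bullet i_f\sim i_{gf}$ for composable $f,g$ in $\mathcal{B}^*$; (3) for horizontally composable 2-cells of $\mathcal{B}$ the formal composite $\psi*\varphi$ is identified with their horizontal composite in $\mathcal{B}$; (4) the left and right unitors of $\mathcal{B}$ are natural with respect to all squares; (5) the associators of $\mathcal{B}$ are natural with respect to all squares. Horizontal identities are the $i_f$; associators and unitors are those of $\mathcal{B}$. *)

theory Defs
  imports Main "HOL-Library.FuncSet" "HOL-Library.Extended_Nat"
begin

section \<open>Categories and functors\<close>

text \<open>\<open>Comp K g f\<close> is the composite of \<open>f\<close> followed by \<open>g\<close>.\<close>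

record ('o, 'm) cat =
  Obj :: "'o set"
  Mor :: "'m set"
  Dom :: "'m \<Rightarrow> 'o"
  Cod :: "'m \<Rightarrow> 'o"
  Id :: "'o \<Rightarrow> 'm"
  Comp :: "'m \<Rightarrow> 'm \<Rightarrow> 'm"

locale category =
  fixes K :: "('o, 'm) cat"
  assumes Dom_Obj: "f \<in> Mor K \<Longrightarrow> Dom K f \<in> Obj K"
    and Cod_Obj: "f \<in> Mor K \<Longrightarrow> Cod K f \<in> Obj K"
    and Id_Mor: "a \<in> Obj K \<Longrightarrow> Id K a \<in> Mor K \<and> Dom K (Id K a) = a \<and> Cod K (Id K a) = a"
    and Comp_Mor: "\<lbrakk>f \<in> Mor K; g \<in> Mor K; Cod K f = Dom K g\<rbrakk>
      \<Longrightarrow> Comp K g f \<in> Mor K \<and> Dom K (Comp K g f) = Dom K f \<and> Cod K (Comp K g f) = Cod K g"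
    and Comp_Id_right: "f \<in> Mor K \<Longrightarrow> Comp K f (Id K (Dom K f)) = f"
    and Comp_Id_left: "f \<in> Mor K \<Longrightarrow> Comp K (Id K (Cod K f)) f = f"
    and Comp_assoc: "\<lbrakk>f \<in> Mor K; g \<in> Mor K; h \<in> Mor K; Cod K f = Dom K g; Cod K g = Dom K h\<rbrakk>
      \<Longrightarrow> Comp K (Comp K h g) f = Comp K h (Comp K g f)"

definition hom_set :: "('o, 'm) cat \<Rightarrow> 'o \<Rightarrow> 'o \<Rightarrow> 'm set" where
  "hom_set K a b = {f \<in> Mor K. Dom K f = a \<and> Cod K f = b}"

definition invertible_in :: "('o, 'm) cat \<Rightarrow> 'm \<Rightarrow> bool" where
  "invertible_in K f \<longleftrightarrow> f \<in> Mor K \<and>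
     (\<exists>g \<in> hom_set K (Cod K f) (Dom K f).
        Comp K g f = Id K (Dom K f) \<and> Comp K f g = Id K (Cod K f))"

definition is_functor ::
  "('o, 'm) cat \<Rightarrow> ('p, 'n) cat \<Rightarrow> ('o \<Rightarrow> 'p) \<Rightarrow> ('m \<Rightarrow> 'n) \<Rightarrow> bool" where
  "is_functor K L F\<^sub>o F\<^sub>m \<longleftrightarrow>
     (\<forall>a \<in> Obj K. F\<^sub>o a \<in> Obj L \<and> F\<^sub>m (Id K a) = Id L (F\<^sub>o a)) \<and>
     (\<forall>f \<in> Mor K. F\<^sub>m f \<in> hom_set L (F\<^sub>o (Dom K f)) (F\<^sub>o (Cod K f))) \<and>
     (\<forall>f \<in> Mor K. \<forall>g \<in> Mor K. Cod K f = Dom K g \<longrightarrow> F\<^sub>m (Comp K g f) = Comp L (F\<^sub>m g) (F\<^sub>m f))"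

text \<open>The pullback of \<open>K\<close> with itself along \<open>t\<close> and \<open>s\<close>. Its elements are written in the order of
  composition, so that \<open>(\<beta>, \<alpha>)\<close> stands for \<open>\<alpha>\<close> followed on its right by \<open>\<beta>\<close>.\<close>

definition composable_pairs ::
  "('h, 's) cat \<Rightarrow> ('h \<Rightarrow> 'o) \<Rightarrow> ('h \<Rightarrow> 'o) \<Rightarrow> ('s \<Rightarrow> 'v) \<Rightarrow> ('s \<Rightarrow> 'v) \<Rightarrow> ('h \<times> 'h, 's \<times> 's) cat" where
  "composable_pairs K s\<^sub>o t\<^sub>o s\<^sub>m t\<^sub>m =
     \<lparr>Obj = {(\<beta>, \<alpha>). \<beta> \<in> Obj K \<and> \<alpha> \<in> Obj K \<and> t\<^sub>o \<alpha> = s\<^sub>o \<beta>},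
      Mor = {(\<Psi>, \<Phi>). \<Psi> \<in> Mor K \<and> \<Phi> \<in> Mor K \<and> t\<^sub>m \<Phi> = s\<^sub>m \<Psi>},
      Dom = map_prod (Dom K) (Dom K),
      Cod = map_prod (Cod K) (Cod K),
      Id = map_prod (Id K) (Id K),
      Comp = (\<lambda>(\<Psi>', \<Phi>') (\<Psi>, \<Phi>). (Comp K \<Psi>' \<Psi>, Comp K \<Phi>' \<Phi>))\<rparr>"


section \<open>Coherence\<close>

text \<open>The part of the axioms that bicategories and double categories have in common: horizontal
  composition \<open>c\<^sub>o\<close>, \<open>c\<^sub>m\<close> and units \<open>u\<close> on a category \<open>K\<close>, with invertible
  \<open>a \<gamma> \<beta> \<alpha> : (\<gamma> * \<beta>) * \<alpha> \<rightarrow> \<gamma> * (\<beta> * \<alpha>)\<close>, \<open>l \<alpha> : u * \<alpha> \<rightarrow> \<alpha>\<close> and \<open>r \<alpha> : \<alpha> * u \<rightarrow> \<alpha>\<close>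
  subject to the pentagon and triangle axioms.\<close>

locale coherent_composition = category K
  for K :: "('h, 's) cat" and Ob :: "'o set" and s\<^sub>o t\<^sub>o :: "'h \<Rightarrow> 'o" and u :: "'o \<Rightarrow> 'h"
    and c\<^sub>o :: "'h \<Rightarrow> 'h \<Rightarrow> 'h" and c\<^sub>m :: "'s \<Rightarrow> 's \<Rightarrow> 's"
    and a :: "'h \<Rightarrow> 'h \<Rightarrow> 'h \<Rightarrow> 's" and l r :: "'h \<Rightarrow> 's" +
  assumes ends: "\<alpha> \<in> Obj K \<Longrightarrow> s\<^sub>o \<alpha> \<in> Ob \<and> t\<^sub>o \<alpha> \<in> Ob"
    and unit_ends: "x \<in> Ob \<Longrightarrow> u x \<in> Obj K \<and> s\<^sub>o (u x) = x \<and> t\<^sub>o (u x) = x"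
    and comp_ends: "\<lbrakk>\<alpha> \<in> Obj K; \<beta> \<in> Obj K; t\<^sub>o \<alpha> = s\<^sub>o \<beta>\<rbrakk>
      \<Longrightarrow> c\<^sub>o \<beta> \<alpha> \<in> Obj K \<and> s\<^sub>o (c\<^sub>o \<beta> \<alpha>) = s\<^sub>o \<alpha> \<and> t\<^sub>o (c\<^sub>o \<beta> \<alpha>) = t\<^sub>o \<beta>"
    and assoc_iso: "\<lbrakk>\<alpha> \<in> Obj K; \<beta> \<in> Obj K; \<gamma> \<in> Obj K; t\<^sub>o \<alpha> = s\<^sub>o \<beta>; t\<^sub>o \<beta> = s\<^sub>o \<gamma>\<rbrakk>
      \<Longrightarrow> a \<gamma> \<beta> \<alpha> \<in> hom_set K (c\<^sub>o (c\<^sub>o \<gamma> \<beta>) \<alpha>) (c\<^sub>o \<gamma> (c\<^sub>o \<beta> \<alpha>)) \<and> invertible_in K (a \<gamma> \<beta> \<alpha>)"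
    and lunit_iso: "\<alpha> \<in> Obj K \<Longrightarrow> l \<alpha> \<in> hom_set K (c\<^sub>o (u (t\<^sub>o \<alpha>)) \<alpha>) \<alpha> \<and> invertible_in K (l \<alpha>)"
    and runit_iso: "\<alpha> \<in> Obj K \<Longrightarrow> r \<alpha> \<in> hom_set K (c\<^sub>o \<alpha> (u (s\<^sub>o \<alpha>))) \<alpha> \<and> invertible_in K (r \<alpha>)"
    and pentagon: "\<lbrakk>\<alpha> \<in> Obj K; \<beta> \<in> Obj K; \<gamma> \<in> Obj K; \<delta> \<in> Obj K;
        t\<^sub>o \<alpha> = s\<^sub>o \<beta>; t\<^sub>o \<beta> = s\<^sub>o \<gamma>; t\<^sub>o \<gamma> = s\<^sub>o \<delta>\<rbrakk>
      \<Longrightarrow> Comp K (a \<delta> \<gamma> (c\<^sub>o \<beta> \<alpha>)) (a (c\<^sub>o \<delta> \<gamma>) \<beta> \<alpha>) =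
          Comp K (c\<^sub>m (Id K \<delta>) (a \<gamma> \<beta> \<alpha>))
            (Comp K (a \<delta> (c\<^sub>o \<gamma> \<beta>) \<alpha>) (c\<^sub>m (a \<delta> \<gamma> \<beta>) (Id K \<alpha>)))"
    and triangle: "\<lbrakk>\<alpha> \<in> Obj K; \<beta> \<in> Obj K; t\<^sub>o \<alpha> = s\<^sub>o \<beta>\<rbrakk>
      \<Longrightarrow> Comp K (c\<^sub>m (Id K \<beta>) (l \<alpha>)) (a \<beta> (u (s\<^sub>o \<beta>)) \<alpha>) = c\<^sub>m (r \<beta>) (Id K \<alpha>)"


section \<open>Decorated bicategories\<close>

text \<open>\<open>Homs\<close> is the disjoint union of the hom-categories: its objects are the 1-cells, its morphisms
  the 2-cells, and its composition is the vertical composition of 2-cells.\<close>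

record ('o, 'h, 'c) bicat =
  Cells0 :: "'o set"
  Homs :: "('h, 'c) cat"
  Src :: "'h \<Rightarrow> 'o"
  Trg :: "'h \<Rightarrow> 'o"
  Unit1 :: "'o \<Rightarrow> 'h"
  HComp1 :: "'h \<Rightarrow> 'h \<Rightarrow> 'h"
  HComp2 :: "'c \<Rightarrow> 'c \<Rightarrow> 'c"
  BAssoc :: "'h \<Rightarrow> 'h \<Rightarrow> 'h \<Rightarrow> 'c"
  BLunit :: "'h \<Rightarrow> 'c"
  BRunit :: "'h \<Rightarrow> 'c"

record ('o, 'v, 'h, 'c) decorated_bicat =
  Bicat :: "('o, 'h, 'c) bicat"
  Deco :: "('o, 'v) cat"

text \<open>Bicategories and decorations are required to be extensional, i.e. their operations take the
  value \<open>undefined\<close> outside of their mathematical domain. In this way equality of records, as in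
  \<open>H\<^sup>*C = B\<close>, is equality of decorated bicategories.\<close>

definition restrict_cat :: "('o, 'm) cat \<Rightarrow> ('o, 'm) cat" where
  "restrict_cat K =
     \<lparr>Obj = Obj K, Mor = Mor K,
      Dom = restrict (Dom K) (Mor K), Cod = restrict (Cod K) (Mor K), Id = restrict (Id K) (Obj K),
      Comp = (\<lambda>g f. if f \<in> Mor K \<and> g \<in> Mor K \<and> Cod K f = Dom K g then Comp K g f else undefined)\<rparr>"

definition restrict_bicat :: "('o, 'h, 'c) bicat \<Rightarrow> ('o, 'h, 'c) bicat" where
  "restrict_bicat B =
     (let Ob1 = Obj (Homs B); Mor2 = Mor (Homs B);
          composable = (\<lambda>\<beta> \<alpha>. \<alpha> \<in> Ob1 \<and> \<beta> \<in> Ob1 \<and> Trg B \<alpha> = Src B \<beta>)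
      in \<lparr>Cells0 = Cells0 B, Homs = restrict_cat (Homs B),
          Src = restrict (Src B) Ob1, Trg = restrict (Trg B) Ob1,
          Unit1 = restrict (Unit1 B) (Cells0 B),
          HComp1 = (\<lambda>\<beta> \<alpha>. if composable \<beta> \<alpha> then HComp1 B \<beta> \<alpha> else undefined),
          HComp2 = (\<lambda>\<psi> \<phi>. if \<phi> \<in> Mor2 \<and> \<psi> \<in> Mor2 \<and> composable (Dom (Homs B) \<psi>) (Dom (Homs B) \<phi>)
                          then HComp2 B \<psi> \<phi> else undefined),
          BAssoc = (\<lambda>\<gamma> \<beta> \<alpha>. if composable \<gamma> \<beta> \<and> composable \<beta> \<alpha> then BAssoc B \<gamma> \<beta> \<alpha> else undefined),
          BLunit = restrict (BLunit B) Ob1, BRunit = restrict (BRunit B) Ob1\<rparr>)"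

locale bicategory =
  coherent_composition "Homs B" "Cells0 B" "Src B" "Trg B" "Unit1 B" "HComp1 B" "HComp2 B"
    "BAssoc B" "BLunit B" "BRunit B"
  for B :: "('o, 'h, 'c) bicat" +
  assumes extensional: "restrict_bicat B = B"
    and cells2_parallel: "\<phi> \<in> Mor (Homs B) \<Longrightarrow>
      Src B (Dom (Homs B) \<phi>) = Src B (Cod (Homs B) \<phi>) \<and> Trg B (Dom (Homs B) \<phi>) = Trg B (Cod (Homs B) \<phi>)"
    and HComp_functor:
      "is_functor
         (composable_pairs (Homs B) (Src B) (Trg B) (Src B \<circ> Dom (Homs B)) (Trg B \<circ> Dom (Homs B)))
         (Homs B) (\<lambda>(\<beta>, \<alpha>). HComp1 B \<beta> \<alpha>) (\<lambda>(\<psi>, \<phi>). HComp2 B \<psi> \<phi>)"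
    and BAssoc_natural:
      "\<lbrakk>\<phi>\<^sub>1 \<in> hom_set (Homs B) \<alpha>\<^sub>1 \<beta>\<^sub>1; \<phi>\<^sub>2 \<in> hom_set (Homs B) \<alpha>\<^sub>2 \<beta>\<^sub>2; \<phi>\<^sub>3 \<in> hom_set (Homs B) \<alpha>\<^sub>3 \<beta>\<^sub>3;
        Trg B \<alpha>\<^sub>1 = Src B \<alpha>\<^sub>2; Trg B \<alpha>\<^sub>2 = Src B \<alpha>\<^sub>3\<rbrakk>
       \<Longrightarrow> Comp (Homs B) (BAssoc B \<beta>\<^sub>3 \<beta>\<^sub>2 \<beta>\<^sub>1) (HComp2 B (HComp2 B \<phi>\<^sub>3 \<phi>\<^sub>2) \<phi>\<^sub>1) =
           Comp (Homs B) (HComp2 B \<phi>\<^sub>3 (HComp2 B \<phi>\<^sub>2 \<phi>\<^sub>1)) (BAssoc B \<alpha>\<^sub>3 \<alpha>\<^sub>2 \<alpha>\<^sub>1)"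
    and BLunit_natural:
      "\<phi> \<in> hom_set (Homs B) \<alpha> \<beta> \<Longrightarrow>
         Comp (Homs B) (BLunit B \<beta>) (HComp2 B (Id (Homs B) (Unit1 B (Trg B \<alpha>))) \<phi>) =
         Comp (Homs B) \<phi> (BLunit B \<alpha>)"
    and BRunit_natural:
      "\<phi> \<in> hom_set (Homs B) \<alpha> \<beta> \<Longrightarrow>
         Comp (Homs B) (BRunit B \<beta>) (HComp2 B \<phi> (Id (Homs B) (Unit1 B (Src B \<alpha>)))) =
         Comp (Homs B) \<phi> (BRunit B \<alpha>)"

locale decorated_bicategory =
  bicategory "Bicat B" + deco: category "Deco B"
  for B :: "('o, 'v, 'h, 'c) decorated_bicat" +
  assumes deco_extensional: "restrict_cat (Deco B) = Deco B"
    and deco_Obj: "Obj (Deco B) = Cells0 (Bicat B)"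


section \<open>Double categories\<close>

text \<open>The suffixes \<open>_ob\<close> and \<open>_sq\<close> refer to the values of a functor on objects and on morphisms:
  \<open>left\<close>, \<open>right\<close>, \<open>hid\<close>, \<open>hcomp\<close> are the functors \<open>s\<close>, \<open>t\<close>, \<open>i\<close>, \<open>*\<close>. The morphisms of \<open>C1\<close> are the
  squares; \<open>Dom (C1 C) \<Phi>\<close> and \<open>Cod (C1 C) \<Phi>\<close> are the top and bottom of \<open>\<Phi>\<close>.\<close>

record ('o, 'v, 'h, 's) double_cat =
  C0 :: "('o, 'v) cat"
  C1 :: "('h, 's) cat"
  left_ob :: "'h \<Rightarrow> 'o"
  left_sq :: "'s \<Rightarrow> 'v"
  right_ob :: "'h \<Rightarrow> 'o"
  right_sq :: "'s \<Rightarrow> 'v"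
  hid_ob :: "'o \<Rightarrow> 'h"
  hid_sq :: "'v \<Rightarrow> 's"
  hcomp_ob :: "'h \<Rightarrow> 'h \<Rightarrow> 'h"
  hcomp_sq :: "'s \<Rightarrow> 's \<Rightarrow> 's"
  DAssoc :: "'h \<Rightarrow> 'h \<Rightarrow> 'h \<Rightarrow> 's"
  DLunit :: "'h \<Rightarrow> 's"
  DRunit :: "'h \<Rightarrow> 's"

definition globular_squares :: "('o, 'v, 'h, 's) double_cat \<Rightarrow> 's set" where
  "globular_squares C =
     {\<Phi> \<in> Mor (C1 C). left_sq C \<Phi> \<in> Id (C0 C) ` Obj (C0 C) \<and> right_sq C \<Phi> \<in> Id (C0 C) ` Obj (C0 C)}"

locale double_category =
  C0: category "C0 C" +
  coherent_composition "C1 C" "Obj (C0 C)" "left_ob C" "right_ob C" "hid_ob C" "hcomp_ob C"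
    "hcomp_sq C" "DAssoc C" "DLunit C" "DRunit C"
  for C :: "('o, 'v, 'h, 's) double_cat" +
  assumes left_functor: "is_functor (C1 C) (C0 C) (left_ob C) (left_sq C)"
    and right_functor: "is_functor (C1 C) (C0 C) (right_ob C) (right_sq C)"
    and hid_functor: "is_functor (C0 C) (C1 C) (hid_ob C) (hid_sq C)"
    and hcomp_functor:
      "is_functor (composable_pairs (C1 C) (left_ob C) (right_ob C) (left_sq C) (right_sq C)) (C1 C)
         (\<lambda>(\<beta>, \<alpha>). hcomp_ob C \<beta> \<alpha>) (\<lambda>(\<Psi>, \<Phi>). hcomp_sq C \<Psi> \<Phi>)"
    and hid_edges: "f \<in> Mor (C0 C) \<Longrightarrow> left_sq C (hid_sq C f) = f \<and> right_sq C (hid_sq C f) = f"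
    and hcomp_edges: "\<lbrakk>\<Phi> \<in> Mor (C1 C); \<Psi> \<in> Mor (C1 C); right_sq C \<Phi> = left_sq C \<Psi>\<rbrakk>
      \<Longrightarrow> left_sq C (hcomp_sq C \<Psi> \<Phi>) = left_sq C \<Phi> \<and> right_sq C (hcomp_sq C \<Psi> \<Phi>) = right_sq C \<Psi>"
    and DAssoc_globular: "\<lbrakk>\<alpha> \<in> Obj (C1 C); \<beta> \<in> Obj (C1 C); \<gamma> \<in> Obj (C1 C);
        right_ob C \<alpha> = left_ob C \<beta>; right_ob C \<beta> = left_ob C \<gamma>\<rbrakk>
      \<Longrightarrow> DAssoc C \<gamma> \<beta> \<alpha> \<in> globular_squares C"
    and DLunit_globular: "\<alpha> \<in> Obj (C1 C) \<Longrightarrow> DLunit C \<alpha> \<in> globular_squares C"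
    and DRunit_globular: "\<alpha> \<in> Obj (C1 C) \<Longrightarrow> DRunit C \<alpha> \<in> globular_squares C"
    and DAssoc_natural:
      "\<lbrakk>\<Phi>\<^sub>1 \<in> hom_set (C1 C) \<alpha>\<^sub>1 \<beta>\<^sub>1; \<Phi>\<^sub>2 \<in> hom_set (C1 C) \<alpha>\<^sub>2 \<beta>\<^sub>2; \<Phi>\<^sub>3 \<in> hom_set (C1 C) \<alpha>\<^sub>3 \<beta>\<^sub>3;
        right_sq C \<Phi>\<^sub>1 = left_sq C \<Phi>\<^sub>2; right_sq C \<Phi>\<^sub>2 = left_sq C \<Phi>\<^sub>3\<rbrakk>
       \<Longrightarrow> Comp (C1 C) (DAssoc C \<beta>\<^sub>3 \<beta>\<^sub>2 \<beta>\<^sub>1) (hcomp_sq C (hcomp_sq C \<Phi>\<^sub>3 \<Phi>\<^sub>2) \<Phi>\<^sub>1) =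
           Comp (C1 C) (hcomp_sq C \<Phi>\<^sub>3 (hcomp_sq C \<Phi>\<^sub>2 \<Phi>\<^sub>1)) (DAssoc C \<alpha>\<^sub>3 \<alpha>\<^sub>2 \<alpha>\<^sub>1)"
    and DLunit_natural:
      "\<Phi> \<in> hom_set (C1 C) \<alpha> \<beta> \<Longrightarrow>
         Comp (C1 C) (DLunit C \<beta>) (hcomp_sq C (hid_sq C (right_sq C \<Phi>)) \<Phi>) =
         Comp (C1 C) \<Phi> (DLunit C \<alpha>)"
    and DRunit_natural:
      "\<Phi> \<in> hom_set (C1 C) \<alpha> \<beta> \<Longrightarrow>
         Comp (C1 C) (DRunit C \<beta>) (hcomp_sq C \<Phi> (hid_sq C (left_sq C \<Phi>))) =
         Comp (C1 C) \<Phi> (DRunit C \<alpha>)"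

definition horizontal_bicategory :: "('o, 'v, 'h, 's) double_cat \<Rightarrow> ('o, 'h, 's) bicat" where
  "horizontal_bicategory C = restrict_bicat
     \<lparr>Cells0 = Obj (C0 C), Homs = (C1 C)\<lparr>Mor := globular_squares C\<rparr>,
      Src = left_ob C, Trg = right_ob C, Unit1 = hid_ob C, HComp1 = hcomp_ob C, HComp2 = hcomp_sq C,
      BAssoc = DAssoc C, BLunit = DLunit C, BRunit = DRunit C\<rparr>"

definition H_star :: "('o, 'v, 'h, 's) double_cat \<Rightarrow> ('o, 'v, 'h, 's) decorated_bicat" where
  "H_star C = \<lparr>Bicat = horizontal_bicategory C, Deco = restrict_cat (C0 C)\<rparr>"


section \<open>Length\<close>

definition generating_squares :: "('o, 'v, 'h, 's) double_cat \<Rightarrow> 's set" where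
  "generating_squares C = globular_squares C \<union> hid_sq C ` Mor (C0 C)"

inductive_set gamma_squares :: "('o, 'v, 'h, 's) double_cat \<Rightarrow> 's set"
  for C :: "('o, 'v, 'h, 's) double_cat" where
  gen: "\<Phi> \<in> generating_squares C \<Longrightarrow> \<Phi> \<in> gamma_squares C"
| vcomp: "\<lbrakk>\<Phi> \<in> gamma_squares C; \<Psi> \<in> gamma_squares C; Cod (C1 C) \<Phi> = Dom (C1 C) \<Psi>\<rbrakk>
    \<Longrightarrow> Comp (C1 C) \<Psi> \<Phi> \<in> gamma_squares C"
| hcomp: "\<lbrakk>\<Phi> \<in> gamma_squares C; \<Psi> \<in> gamma_squares C; right_sq C \<Phi> = left_sq C \<Psi>\<rbrakk>
    \<Longrightarrow> hcomp_sq C \<Psi> \<Phi> \<in> gamma_squares C"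

definition gamma :: "('o, 'v, 'h, 's) double_cat \<Rightarrow> ('o, 'v, 'h, 's) double_cat" where
  "gamma C = C\<lparr>C1 := (C1 C)\<lparr>Mor := gamma_squares C\<rparr>\<rparr>"

inductive_set horizontal_composites :: "('o, 'v, 'h, 's) double_cat \<Rightarrow> 's set \<Rightarrow> 's set"
  for C :: "('o, 'v, 'h, 's) double_cat" and X :: "'s set" where
  base: "\<Phi> \<in> X \<Longrightarrow> \<Phi> \<in> horizontal_composites C X"
| hcomp: "\<lbrakk>\<Phi> \<in> horizontal_composites C X; \<Psi> \<in> horizontal_composites C X; right_sq C \<Phi> = left_sq C \<Psi>\<rbrakk>
    \<Longrightarrow> hcomp_sq C \<Psi> \<Phi> \<in> horizontal_composites C X"

inductive_set generated_subcategory :: "('o, 'm) cat \<Rightarrow> 'm set \<Rightarrow> 'm set"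
  for K :: "('o, 'm) cat" and X :: "'m set" where
  base: "f \<in> X \<Longrightarrow> f \<in> generated_subcategory K X"
| id_dom: "f \<in> X \<Longrightarrow> Id K (Dom K f) \<in> generated_subcategory K X"
| id_cod: "f \<in> X \<Longrightarrow> Id K (Cod K f) \<in> generated_subcategory K X"
| comp: "\<lbrakk>f \<in> generated_subcategory K X; g \<in> generated_subcategory K X; Cod K f = Dom K g\<rbrakk>
    \<Longrightarrow> Comp K g f \<in> generated_subcategory K X"

text \<open>\<open>V_squares C k\<close> is the set of morphisms of \<open>V\<^sup>k\<^sub>C\<close> for \<open>k \<ge> 1\<close>, and
  \<open>horizontal_composites C (V_squares C (k - 1))\<close> is \<open>H\<^sup>k\<^sub>C\<close>. The value at \<open>0\<close> is an auxiliary start of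
  the recursion and does not count for the length.\<close>

primrec V_squares :: "('o, 'v, 'h, 's) double_cat \<Rightarrow> nat \<Rightarrow> 's set" where
  "V_squares C 0 = generating_squares C"
| "V_squares C (Suc k) = generated_subcategory (C1 C) (horizontal_composites C (V_squares C k))"

definition globularly_generated_length :: "('o, 'v, 'h, 's) double_cat \<Rightarrow> enat" where
  "globularly_generated_length C =
     (if \<exists>k\<ge>1. V_squares C k = Mor (C1 C)
      then enat (LEAST k. k \<ge> 1 \<and> V_squares C k = Mor (C1 C)) else \<infinity>)"

definition double_length :: "('o, 'v, 'h, 's) double_cat \<Rightarrow> enat" where
  "double_length C = globularly_generated_length (gamma C)"


section \<open>The free globularly generated double category\<close>

text \<open>Formal expressions. \<open>FCell \<phi>\<close> and \<open>FHid f\<close> are the formal squares \<open>\<phi>\<close> and \<open>i\<^sub>f\<close>;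
  \<open>FV \<Psi> \<Phi>\<close> stands for \<open>\<Psi> \<bullet> \<Phi>\<close> and \<open>FH \<Psi> \<Phi>\<close> for \<open>\<Psi> * \<Phi>\<close>.\<close>

datatype ('v, 'c) formal_sq =
    FCell 'c
  | FHid 'v
  | FV "('v, 'c) formal_sq" "('v, 'c) formal_sq"
  | FH "('v, 'c) formal_sq" "('v, 'c) formal_sq"

primrec ftop :: "('o, 'v, 'h, 'c) decorated_bicat \<Rightarrow> ('v, 'c) formal_sq \<Rightarrow> 'h" where
  "ftop B (FCell \<phi>) = Dom (Homs (Bicat B)) \<phi>"
| "ftop B (FHid f) = Unit1 (Bicat B) (Dom (Deco B) f)"
| "ftop B (FV \<Psi> \<Phi>) = ftop B \<Phi>"
| "ftop B (FH \<Psi> \<Phi>) = HComp1 (Bicat B) (ftop B \<Psi>) (ftop B \<Phi>)"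

primrec fbot :: "('o, 'v, 'h, 'c) decorated_bicat \<Rightarrow> ('v, 'c) formal_sq \<Rightarrow> 'h" where
  "fbot B (FCell \<phi>) = Cod (Homs (Bicat B)) \<phi>"
| "fbot B (FHid f) = Unit1 (Bicat B) (Cod (Deco B) f)"
| "fbot B (FV \<Psi> \<Phi>) = fbot B \<Psi>"
| "fbot B (FH \<Psi> \<Phi>) = HComp1 (Bicat B) (fbot B \<Psi>) (fbot B \<Phi>)"

primrec fleft :: "('o, 'v, 'h, 'c) decorated_bicat \<Rightarrow> ('v, 'c) formal_sq \<Rightarrow> 'v" where
  "fleft B (FCell \<phi>) = Id (Deco B) (Src (Bicat B) (Dom (Homs (Bicat B)) \<phi>))"
| "fleft B (FHid f) = f"
| "fleft B (FV \<Psi> \<Phi>) = Comp (Deco B) (fleft B \<Psi>) (fleft B \<Phi>)"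
| "fleft B (FH \<Psi> \<Phi>) = fleft B \<Phi>"

primrec fright :: "('o, 'v, 'h, 'c) decorated_bicat \<Rightarrow> ('v, 'c) formal_sq \<Rightarrow> 'v" where
  "fright B (FCell \<phi>) = Id (Deco B) (Trg (Bicat B) (Dom (Homs (Bicat B)) \<phi>))"
| "fright B (FHid f) = f"
| "fright B (FV \<Psi> \<Phi>) = Comp (Deco B) (fright B \<Psi>) (fright B \<Phi>)"
| "fright B (FH \<Psi> \<Phi>) = fright B \<Psi>"

primrec well_formed :: "('o, 'v, 'h, 'c) decorated_bicat \<Rightarrow> ('v, 'c) formal_sq \<Rightarrow> bool" where
  "well_formed B (FCell \<phi>) \<longleftrightarrow> \<phi> \<in> Mor (Homs (Bicat B))"
| "well_formed B (FHid f) \<longleftrightarrow> f \<in> Mor (Deco B)"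
| "well_formed B (FV \<Psi> \<Phi>) \<longleftrightarrow> well_formed B \<Psi> \<and> well_formed B \<Phi> \<and> fbot B \<Phi> = ftop B \<Psi>"
| "well_formed B (FH \<Psi> \<Phi>) \<longleftrightarrow> well_formed B \<Psi> \<and> well_formed B \<Phi> \<and> fright B \<Phi> = fleft B \<Psi>"

inductive_set fequiv ::
  "('o, 'v, 'h, 'c) decorated_bicat \<Rightarrow> (('v, 'c) formal_sq \<times> ('v, 'c) formal_sq) set"
  for B :: "('o, 'v, 'h, 'c) decorated_bicat" where
  refl: "well_formed B \<Phi> \<Longrightarrow> (\<Phi>, \<Phi>) \<in> fequiv B"
| sym: "(\<Phi>, \<Psi>) \<in> fequiv B \<Longrightarrow> (\<Psi>, \<Phi>) \<in> fequiv B"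
| trans: "\<lbrakk>(\<Phi>, \<Psi>) \<in> fequiv B; (\<Psi>, \<Theta>) \<in> fequiv B\<rbrakk> \<Longrightarrow> (\<Phi>, \<Theta>) \<in> fequiv B"
| FV_cong: "\<lbrakk>(\<Phi>, \<Phi>') \<in> fequiv B; (\<Psi>, \<Psi>') \<in> fequiv B;
      well_formed B (FV \<Psi> \<Phi>); well_formed B (FV \<Psi>' \<Phi>')\<rbrakk> \<Longrightarrow> (FV \<Psi> \<Phi>, FV \<Psi>' \<Phi>') \<in> fequiv B"
| FH_cong: "\<lbrakk>(\<Phi>, \<Phi>') \<in> fequiv B; (\<Psi>, \<Psi>') \<in> fequiv B;
      well_formed B (FH \<Psi> \<Phi>); well_formed B (FH \<Psi>' \<Phi>')\<rbrakk> \<Longrightarrow> (FH \<Psi> \<Phi>, FH \<Psi>' \<Phi>') \<in> fequiv B"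
| hid_id: "a \<in> Cells0 (Bicat B)
    \<Longrightarrow> (FHid (Id (Deco B) a), FCell (Id (Homs (Bicat B)) (Unit1 (Bicat B) a))) \<in> fequiv B"
| FV_assoc: "\<lbrakk>well_formed B (FV \<Psi> \<Phi>); well_formed B (FV \<Theta> \<Psi>)\<rbrakk>
    \<Longrightarrow> (FV (FV \<Theta> \<Psi>) \<Phi>, FV \<Theta> (FV \<Psi> \<Phi>)) \<in> fequiv B"
| FV_id_top: "well_formed B \<Phi>
    \<Longrightarrow> (FV \<Phi> (FCell (Id (Homs (Bicat B)) (ftop B \<Phi>))), \<Phi>) \<in> fequiv B"
| FV_id_bot: "well_formed B \<Phi>
    \<Longrightarrow> (FV (FCell (Id (Homs (Bicat B)) (fbot B \<Phi>))) \<Phi>, \<Phi>) \<in> fequiv B"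
| interchange: "\<lbrakk>well_formed B (FH (FV \<Psi>\<^sub>2 \<Psi>\<^sub>1) (FV \<Phi>\<^sub>2 \<Phi>\<^sub>1)); well_formed B (FV (FH \<Psi>\<^sub>2 \<Phi>\<^sub>2) (FH \<Psi>\<^sub>1 \<Phi>\<^sub>1))\<rbrakk>
    \<Longrightarrow> (FH (FV \<Psi>\<^sub>2 \<Psi>\<^sub>1) (FV \<Phi>\<^sub>2 \<Phi>\<^sub>1), FV (FH \<Psi>\<^sub>2 \<Phi>\<^sub>2) (FH \<Psi>\<^sub>1 \<Phi>\<^sub>1)) \<in> fequiv B"
| FCell_vcomp: "well_formed B (FV (FCell \<psi>) (FCell \<phi>))
    \<Longrightarrow> (FV (FCell \<psi>) (FCell \<phi>), FCell (Comp (Homs (Bicat B)) \<psi> \<phi>)) \<in> fequiv B"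
| FHid_vcomp: "\<lbrakk>f \<in> Mor (Deco B); g \<in> Mor (Deco B); Cod (Deco B) f = Dom (Deco B) g\<rbrakk>
    \<Longrightarrow> (FV (FHid g) (FHid f), FHid (Comp (Deco B) g f)) \<in> fequiv B"
| FCell_hcomp: "well_formed B (FH (FCell \<psi>) (FCell \<phi>))
    \<Longrightarrow> (FH (FCell \<psi>) (FCell \<phi>), FCell (HComp2 (Bicat B) \<psi> \<phi>)) \<in> fequiv B"
| lunit_natural: "well_formed B \<Phi>
    \<Longrightarrow> (FV (FCell (BLunit (Bicat B) (fbot B \<Phi>))) (FH (FHid (fright B \<Phi>)) \<Phi>),
        FV \<Phi> (FCell (BLunit (Bicat B) (ftop B \<Phi>)))) \<in> fequiv B"
| runit_natural: "well_formed B \<Phi>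
    \<Longrightarrow> (FV (FCell (BRunit (Bicat B) (fbot B \<Phi>))) (FH \<Phi> (FHid (fleft B \<Phi>))),
        FV \<Phi> (FCell (BRunit (Bicat B) (ftop B \<Phi>)))) \<in> fequiv B"
| assoc_natural: "\<lbrakk>well_formed B (FH \<Phi>\<^sub>2 \<Phi>\<^sub>1); well_formed B (FH \<Phi>\<^sub>3 \<Phi>\<^sub>2)\<rbrakk>
    \<Longrightarrow> (FV (FCell (BAssoc (Bicat B) (fbot B \<Phi>\<^sub>3) (fbot B \<Phi>\<^sub>2) (fbot B \<Phi>\<^sub>1))) (FH (FH \<Phi>\<^sub>3 \<Phi>\<^sub>2) \<Phi>\<^sub>1),
        FV (FH \<Phi>\<^sub>3 (FH \<Phi>\<^sub>2 \<Phi>\<^sub>1)) (FCell (BAssoc (Bicat B) (ftop B \<Phi>\<^sub>3) (ftop B \<Phi>\<^sub>2) (ftop B \<Phi>\<^sub>1))))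
      \<in> fequiv B"

definition fclass :: "('o, 'v, 'h, 'c) decorated_bicat \<Rightarrow> ('v, 'c) formal_sq \<Rightarrow> ('v, 'c) formal_sq set" where
  "fclass B \<Phi> = fequiv B `` {\<Phi>}"

text \<open>Equivalent expressions have the same boundary, so the functions applied with \<open>the_elem\<close> below
  are constant on classes.\<close>

definition Q :: "('o, 'v, 'h, 'c) decorated_bicat \<Rightarrow> ('o, 'v, 'h, ('v, 'c) formal_sq set) double_cat" where
  "Q B =
     \<lparr>C0 = Deco B,
      C1 = \<lparr>Obj = Obj (Homs (Bicat B)),
            Mor = {\<Phi>. well_formed B \<Phi>} // fequiv B,
            Dom = (\<lambda>X. the_elem (ftop B ` X)),
            Cod = (\<lambda>X. the_elem (fbot B ` X)),
            Id = (\<lambda>\<alpha>. fclass B (FCell (Id (Homs (Bicat B)) \<alpha>))),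
            Comp = (\<lambda>Y X. \<Union>\<Psi>\<in>Y. \<Union>\<Phi>\<in>X. fclass B (FV \<Psi> \<Phi>))\<rparr>,
      left_ob = Src (Bicat B),
      left_sq = (\<lambda>X. the_elem (fleft B ` X)),
      right_ob = Trg (Bicat B),
      right_sq = (\<lambda>X. the_elem (fright B ` X)),
      hid_ob = Unit1 (Bicat B),
      hid_sq = (\<lambda>f. fclass B (FHid f)),
      hcomp_ob = HComp1 (Bicat B),
      hcomp_sq = (\<lambda>Y X. \<Union>\<Psi>\<in>Y. \<Union>\<Phi>\<in>X. fclass B (FH \<Psi> \<Phi>)),
      DAssoc = (\<lambda>\<gamma> \<beta> \<alpha>. fclass B (FCell (BAssoc (Bicat B) \<gamma> \<beta> \<alpha>))),
      DLunit = (\<lambda>\<alpha>. fclass B (FCell (BLunit (Bicat B) \<alpha>))),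
      DRunit = (\<lambda>\<alpha>. fclass B (FCell (BRunit (Bicat B) \<alpha>)))\<rparr>"

definition decorated_bicat_length :: "('o, 'v, 'h, 'c) decorated_bicat \<Rightarrow> enat" where
  "decorated_bicat_length B = double_length (Q B)"

end

theory Submission
  imports Defs
begin

text \<open>Since \<open>H\<^sup>*C = B\<close>, every formal square over \<open>B\<close> evaluates to a square of \<open>C\<close>, and all the relations
  imposed on formal squares hold in \<open>C\<close>. Evaluation therefore descends to a double functor from \<open>Q B\<close>
  onto \<open>\<gamma>C\<close>, which maps \<open>V\<^sup>k\<close> of \<open>Q B\<close> into \<open>V\<^sup>k\<close> of \<open>\<gamma>C\<close>. If the former contains all squares of \<open>Q B\<close>, the
  latter contains all squares of \<open>\<gamma>C\<close>.\<close>

section \<open>Evaluation of formal squares, passage to \<open>gamma C\<close>, comparison of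
  lengths\<close>

primrec eval_sq :: "('o, 'v, 'h, 's) double_cat \<Rightarrow> ('v, 's) formal_sq \<Rightarrow> 's" where
  "eval_sq C (FCell \<phi>) = \<phi>"
| "eval_sq C (FHid f) = hid_sq C f"
| "eval_sq C (FV \<Psi> \<Phi>) = Comp (C1 C) (eval_sq C \<Psi>) (eval_sq C \<Phi>)"
| "eval_sq C (FH \<Psi> \<Phi>) = hcomp_sq C (eval_sq C \<Psi>) (eval_sq C \<Phi>)"

lemma gamma_simps [simp]:
  "C0 (gamma C) = C0 C" "Obj (C1 (gamma C)) = Obj (C1 C)" "Mor (C1 (gamma C)) = gamma_squares C"
  "Dom (C1 (gamma C)) = Dom (C1 C)" "Cod (C1 (gamma C)) = Cod (C1 C)"
  "Id (C1 (gamma C)) = Id (C1 C)" "Comp (C1 (gamma C)) = Comp (C1 C)"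
  "left_sq (gamma C) = left_sq C" "right_sq (gamma C) = right_sq C"
  "hid_sq (gamma C) = hid_sq C" "hcomp_sq (gamma C) = hcomp_sq C"
  by (simp_all add: gamma_def)

text \<open>Globular squares are generators, so \<open>gamma\<close> discards none of them. The
  assumption stands for the inclusion of \<open>gamma_squares C\<close> in the squares of
  \<open>C\<close>, which holds in every double category.\<close>

lemma globular_squares_gamma:
  assumes "\<And>\<Phi>. \<Phi> \<in> gamma_squares C \<Longrightarrow> \<Phi> \<in> Mor (C1 C)"
  shows "globular_squares (gamma C) = globular_squares C"
  using assms by (auto simp: globular_squares_def generating_squares_def intro: gamma_squares.gen)

text \<open>A stage that exhausts \<open>D\<close> also exhausts \<open>C\<close>, so the minimum
  for \<open>C\<close> is taken over at least as many stages. If no stage exhausts \<open>D\<close>,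
  the bound is \<infinity>.\<close>

lemma globularly_generated_length_mono:
  assumes "\<And>k. V_squares D k = Mor (C1 D) \<Longrightarrow> V_squares C k = Mor (C1 C)"
  shows "globularly_generated_length C \<le> globularly_generated_length D"
proof (cases "\<exists>k\<ge>1. V_squares D k = Mor (C1 D)")
  case True
  let ?n = "LEAST k. k \<ge> 1 \<and> V_squares D k = Mor (C1 D)"
  have "?n \<ge> 1 \<and> V_squares D ?n = Mor (C1 D)"
    using True by (rule LeastI_ex)
  then have n: "?n \<ge> 1 \<and> V_squares C ?n = Mor (C1 C)"
    using assms by blast
  then have "(LEAST k. k \<ge> 1 \<and> V_squares C k = Mor (C1 C)) \<le> ?n"
    by (rule Least_le)
  then show ?thesis
    using True n unfolding globularly_generated_length_def by auto
next
  case False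
  then show ?thesis unfolding globularly_generated_length_def if_not_P[OF False] by simp
qed

section \<open>Functoriality of edges, units and horizontal composition\<close>

context double_category
begin

text \<open>Inside the locale the hypothesis \<open>H_star C = B\<close> becomes a definition, so
  whatever is needed about 2-cells and 1-cells can be read off from \<open>C\<close>.\<close>

abbreviation B :: "('o, 'v, 'h, 's) decorated_bicat"
  where "B \<equiv> H_star C"

lemma left_sq_hom:
  assumes "\<Phi> \<in> Mor (C1 C)"
  shows "left_sq C \<Phi> \<in> Mor (C0 C)" "Dom (C0 C) (left_sq C \<Phi>) = left_ob C (Dom (C1 C) \<Phi>)"
    "Cod (C0 C) (left_sq C \<Phi>) = left_ob C (Cod (C1 C) \<Phi>)"
  using left_functor assms by (auto simp: is_functor_def hom_set_def)

lemma right_sq_hom: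
  assumes "\<Phi> \<in> Mor (C1 C)"
  shows "right_sq C \<Phi> \<in> Mor (C0 C)" "Dom (C0 C) (right_sq C \<Phi>) = right_ob C (Dom (C1 C) \<Phi>)"
    "Cod (C0 C) (right_sq C \<Phi>) = right_ob C (Cod (C1 C) \<Phi>)"
  using right_functor assms by (auto simp: is_functor_def hom_set_def)

lemma hid_sq_hom:
  assumes "f \<in> Mor (C0 C)"
  shows "hid_sq C f \<in> Mor (C1 C)" "Dom (C1 C) (hid_sq C f) = hid_ob C (Dom (C0 C) f)"
    "Cod (C1 C) (hid_sq C f) = hid_ob C (Cod (C0 C) f)"
  using hid_functor assms by (auto simp: is_functor_def hom_set_def)

lemma hid_sq_Id: "x \<in> Obj (C0 C) \<Longrightarrow> hid_sq C (Id (C0 C) x) = Id (C1 C) (hid_ob C x)"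
  using hid_functor by (auto simp: is_functor_def)

lemma hid_sq_Comp:
  "\<lbrakk>f \<in> Mor (C0 C); g \<in> Mor (C0 C); Cod (C0 C) f = Dom (C0 C) g\<rbrakk>
    \<Longrightarrow> hid_sq C (Comp (C0 C) g f) = Comp (C1 C) (hid_sq C g) (hid_sq C f)"
  using hid_functor by (auto simp: is_functor_def)

lemma edges_Id:
  assumes "\<alpha> \<in> Obj (C1 C)"
  shows "left_sq C (Id (C1 C) \<alpha>) = Id (C0 C) (left_ob C \<alpha>)"
    "right_sq C (Id (C1 C) \<alpha>) = Id (C0 C) (right_ob C \<alpha>)"
  using left_functor right_functor assms by (auto simp: is_functor_def)

lemma edges_Comp:
  assumes "\<Phi> \<in> Mor (C1 C)" "\<Psi> \<in> Mor (C1 C)" "Cod (C1 C) \<Phi> = Dom (C1 C) \<Psi>"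
  shows "left_sq C (Comp (C1 C) \<Psi> \<Phi>) = Comp (C0 C) (left_sq C \<Psi>) (left_sq C \<Phi>)"
    "right_sq C (Comp (C1 C) \<Psi> \<Phi>) = Comp (C0 C) (right_sq C \<Psi>) (right_sq C \<Phi>)"
  using left_functor right_functor assms by (auto simp: is_functor_def)

lemma hcomp_sq_hom:
  assumes "\<Phi> \<in> Mor (C1 C)" "\<Psi> \<in> Mor (C1 C)" "right_sq C \<Phi> = left_sq C \<Psi>"
  shows "hcomp_sq C \<Psi> \<Phi> \<in> Mor (C1 C)"
    "Dom (C1 C) (hcomp_sq C \<Psi> \<Phi>) = hcomp_ob C (Dom (C1 C) \<Psi>) (Dom (C1 C) \<Phi>)"
    "Cod (C1 C) (hcomp_sq C \<Psi> \<Phi>) = hcomp_ob C (Cod (C1 C) \<Psi>) (Cod (C1 C) \<Phi>)"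
proof -
  let ?P = "composable_pairs (C1 C) (left_ob C) (right_ob C) (left_sq C) (right_sq C)"
  have m: "(\<Psi>, \<Phi>) \<in> Mor ?P"
    using assms by (simp add: composable_pairs_def)
  have "(\<lambda>(\<Psi>, \<Phi>). hcomp_sq C \<Psi> \<Phi>) (\<Psi>, \<Phi>) \<in> hom_set (C1 C)
      ((\<lambda>(\<beta>, \<alpha>). hcomp_ob C \<beta> \<alpha>) (Dom ?P (\<Psi>, \<Phi>)))
      ((\<lambda>(\<beta>, \<alpha>). hcomp_ob C \<beta> \<alpha>) (Cod ?P (\<Psi>, \<Phi>)))"
    using hcomp_functor m unfolding is_functor_def by blast
  then show "hcomp_sq C \<Psi> \<Phi> \<in> Mor (C1 C)"
    "Dom (C1 C) (hcomp_sq C \<Psi> \<Phi>) = hcomp_ob C (Dom (C1 C) \<Psi>) (Dom (C1 C) \<Phi>)"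
    "Cod (C1 C) (hcomp_sq C \<Psi> \<Phi>) = hcomp_ob C (Cod (C1 C) \<Psi>) (Cod (C1 C) \<Phi>)"
    by (auto simp: composable_pairs_def hom_set_def)
qed

text \<open>This is functoriality of horizontal composition on the pullback
  \<open>composable_pairs\<close>, where vertical composites are taken componentwise.\<close>

lemma hcomp_sq_interchange:
  assumes "\<Phi>\<^sub>1 \<in> Mor (C1 C)" "\<Phi>\<^sub>2 \<in> Mor (C1 C)" "\<Psi>\<^sub>1 \<in> Mor (C1 C)" "\<Psi>\<^sub>2 \<in> Mor (C1 C)"
    and "right_sq C \<Phi>\<^sub>1 = left_sq C \<Psi>\<^sub>1" "right_sq C \<Phi>\<^sub>2 = left_sq C \<Psi>\<^sub>2"
    and "Cod (C1 C) \<Phi>\<^sub>1 = Dom (C1 C) \<Phi>\<^sub>2" "Cod (C1 C) \<Psi>\<^sub>1 = Dom (C1 C) \<Psi>\<^sub>2"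
  shows "hcomp_sq C (Comp (C1 C) \<Psi>\<^sub>2 \<Psi>\<^sub>1) (Comp (C1 C) \<Phi>\<^sub>2 \<Phi>\<^sub>1)
    = Comp (C1 C) (hcomp_sq C \<Psi>\<^sub>2 \<Phi>\<^sub>2) (hcomp_sq C \<Psi>\<^sub>1 \<Phi>\<^sub>1)"
proof -
  let ?P = "composable_pairs (C1 C) (left_ob C) (right_ob C) (left_sq C) (right_sq C)"
  have m: "(\<Psi>\<^sub>1, \<Phi>\<^sub>1) \<in> Mor ?P" "(\<Psi>\<^sub>2, \<Phi>\<^sub>2) \<in> Mor ?P" "Cod ?P (\<Psi>\<^sub>1, \<Phi>\<^sub>1) = Dom ?P (\<Psi>\<^sub>2, \<Phi>\<^sub>2)"
    using assms by (simp_all add: composable_pairs_def)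
  have "(\<lambda>(\<Psi>, \<Phi>). hcomp_sq C \<Psi> \<Phi>) (Comp ?P (\<Psi>\<^sub>2, \<Phi>\<^sub>2) (\<Psi>\<^sub>1, \<Phi>\<^sub>1)) =
      Comp (C1 C) ((\<lambda>(\<Psi>, \<Phi>). hcomp_sq C \<Psi> \<Phi>) (\<Psi>\<^sub>2, \<Phi>\<^sub>2)) ((\<lambda>(\<Psi>, \<Phi>). hcomp_sq C \<Psi> \<Phi>) (\<Psi>\<^sub>1, \<Phi>\<^sub>1))"
    using hcomp_functor m unfolding is_functor_def by blast
  then show ?thesis
    by (simp add: composable_pairs_def)
qed

section \<open>Globular squares\<close>

text \<open>The definition only asks the edges to be identities somewhere. An identity determines
  its object as its domain and codomain, which pins that object to the ends of the top and of the
  bottom.\<close>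

lemma globularD:
  assumes "\<phi> \<in> globular_squares C"
  shows "\<phi> \<in> Mor (C1 C)"
    "left_sq C \<phi> = Id (C0 C) (left_ob C (Dom (C1 C) \<phi>))"
    "right_sq C \<phi> = Id (C0 C) (right_ob C (Dom (C1 C) \<phi>))"
    "left_ob C (Cod (C1 C) \<phi>) = left_ob C (Dom (C1 C) \<phi>)"
    "right_ob C (Cod (C1 C) \<phi>) = right_ob C (Dom (C1 C) \<phi>)"
proof -
  show m: "\<phi> \<in> Mor (C1 C)"
    using assms by (simp add: globular_squares_def)
  obtain x y where x: "x \<in> Obj (C0 C)" "left_sq C \<phi> = Id (C0 C) x"
    and y: "y \<in> Obj (C0 C)" "right_sq C \<phi> = Id (C0 C) y"
    using assms by (auto simp: globular_squares_def)
  show "left_sq C \<phi> = Id (C0 C) (left_ob C (Dom (C1 C) \<phi>))"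
    "right_sq C \<phi> = Id (C0 C) (right_ob C (Dom (C1 C) \<phi>))"
    "left_ob C (Cod (C1 C) \<phi>) = left_ob C (Dom (C1 C) \<phi>)"
    "right_ob C (Cod (C1 C) \<phi>) = right_ob C (Dom (C1 C) \<phi>)"
    using x y C0.Id_Mor left_sq_hom[OF m] right_sq_hom[OF m] by metis+
qed

lemma globularI:
  assumes "\<phi> \<in> Mor (C1 C)" "left_sq C \<phi> = Id (C0 C) x" "right_sq C \<phi> = Id (C0 C) y"
    "x \<in> Obj (C0 C)" "y \<in> Obj (C0 C)"
  shows "\<phi> \<in> globular_squares C"
  using assms by (auto simp: globular_squares_def)

lemma Id_globular: "\<alpha> \<in> Obj (C1 C) \<Longrightarrow> Id (C1 C) \<alpha> \<in> globular_squares C"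
  using Id_Mor edges_Id ends by (intro globularI) blast+

text \<open>All tops and bottoms involved share their two ends, so each edge of the composite is an
  identity composed with itself.\<close>

lemma globular_Comp:
  assumes "\<phi> \<in> globular_squares C" "\<psi> \<in> globular_squares C" "Cod (C1 C) \<phi> = Dom (C1 C) \<psi>"
  shows "Comp (C1 C) \<psi> \<phi> \<in> globular_squares C"
proof -
  note p = globularD[OF assms(1)] and q = globularD[OF assms(2)]
  note c = Comp_Mor[OF p(1) q(1) assms(3)]
  have o: "left_ob C (Dom (C1 C) \<phi>) \<in> Obj (C0 C)" "right_ob C (Dom (C1 C) \<phi>) \<in> Obj (C0 C)"
    using ends Dom_Obj p(1) by blast+
  show ?thesis
  proof (rule globularI[OF _ _ _ o])
    show "Comp (C1 C) \<psi> \<phi> \<in> Mor (C1 C)" using c by blast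
    show "left_sq C (Comp (C1 C) \<psi> \<phi>) = Id (C0 C) (left_ob C (Dom (C1 C) \<phi>))"
      using edges_Comp[OF p(1) q(1) assms(3)] p q assms(3) C0.Id_Mor[OF o(1)] C0.Comp_Id_right
      by metis
    show "right_sq C (Comp (C1 C) \<psi> \<phi>) = Id (C0 C) (right_ob C (Dom (C1 C) \<phi>))"
      using edges_Comp[OF p(1) q(1) assms(3)] p q assms(3) C0.Id_Mor[OF o(2)] C0.Comp_Id_right
      by metis
  qed
qed

lemma globular_hcomp:
  assumes "\<phi> \<in> globular_squares C" "\<psi> \<in> globular_squares C" "right_sq C \<phi> = left_sq C \<psi>"
  shows "hcomp_sq C \<psi> \<phi> \<in> globular_squares C"
  using assms hcomp_edges[of \<phi> \<psi>] hcomp_sq_hom[of \<phi> \<psi>] by (auto simp: globular_squares_def)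

section \<open>The filtration stays inside \<open>gamma C\<close>\<close>

lemma gamma_squares_Mor: "\<Phi> \<in> gamma_squares C \<Longrightarrow> \<Phi> \<in> Mor (C1 C)"
proof (induction rule: gamma_squares.induct)
  case (gen \<Phi>)
  then show ?case by (auto simp: generating_squares_def globular_squares_def hid_sq_hom)
qed (simp_all add: Comp_Mor hcomp_sq_hom)

lemma Id_gamma_squares: "\<alpha> \<in> Obj (C1 C) \<Longrightarrow> Id (C1 C) \<alpha> \<in> gamma_squares C"
  by (simp add: Id_globular gamma_squares.gen generating_squares_def)

lemma horizontal_composites_gamma:
  assumes "X \<subseteq> gamma_squares C" "\<Phi> \<in> horizontal_composites (gamma C) X"
  shows "\<Phi> \<in> gamma_squares C"
  using assms(2)
  by (induction rule: horizontal_composites.induct) (use assms(1) gamma_squares.hcomp in auto)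

lemma generated_subcategory_gamma:
  assumes "X \<subseteq> gamma_squares C" "\<Phi> \<in> generated_subcategory (C1 (gamma C)) X"
  shows "\<Phi> \<in> gamma_squares C"
  using assms(2)
proof (induction rule: generated_subcategory.induct)
  case (id_dom f)
  then show ?case using assms(1) Dom_Obj gamma_squares_Mor Id_gamma_squares by auto
next
  case (id_cod f)
  then show ?case using assms(1) Cod_Obj gamma_squares_Mor Id_gamma_squares by auto
qed (use assms(1) gamma_squares.vcomp in auto)

text \<open>The set \<open>gamma_squares C\<close> contains the generators and identities and is
  closed under both compositions. Hence a stage fills \<open>gamma C\<close> as soon as it contains
  \<open>gamma_squares C\<close>.\<close>

lemma V_squares_gamma: "V_squares (gamma C) k \<subseteq> gamma_squares C"
proof (induction k)
  case 0
  show ?case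
    by (auto simp: generating_squares_def globular_squares_def intro: gamma_squares.gen)
next
  case (Suc k)
  then have "horizontal_composites (gamma C) (V_squares (gamma C) k) \<subseteq> gamma_squares C"
    using horizontal_composites_gamma by blast
  then show ?case
    using generated_subcategory_gamma by auto
qed

section \<open>The operations of \<open>H_star C\<close> in terms of \<open>C\<close>\<close>

text \<open>Extensionality replaces values outside the domains by \<open>undefined\<close>, so
  agreement with \<open>C\<close> comes with membership premises.\<close>

lemma H_star_simps [simp]:
  "Deco B = restrict_cat (C0 C)"
  "Mor (Deco B) = Mor (C0 C)"
  "Cells0 (Bicat B) = Obj (C0 C)"
  "Mor (Homs (Bicat B)) = globular_squares C"
  "Obj (Homs (Bicat B)) = Obj (C1 C)"
  "\<alpha> \<in> Obj (C1 C) \<Longrightarrow> Src (Bicat B) \<alpha> = left_ob C \<alpha>"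
  "\<alpha> \<in> Obj (C1 C) \<Longrightarrow> Trg (Bicat B) \<alpha> = right_ob C \<alpha>"
  "x \<in> Obj (C0 C) \<Longrightarrow> Unit1 (Bicat B) x = hid_ob C x"
  "\<phi> \<in> globular_squares C \<Longrightarrow> Dom (Homs (Bicat B)) \<phi> = Dom (C1 C) \<phi>"
  "\<phi> \<in> globular_squares C \<Longrightarrow> Cod (Homs (Bicat B)) \<phi> = Cod (C1 C) \<phi>"
  "\<alpha> \<in> Obj (C1 C) \<Longrightarrow> Id (Homs (Bicat B)) \<alpha> = Id (C1 C) \<alpha>"
  "\<alpha> \<in> Obj (C1 C) \<Longrightarrow> BLunit (Bicat B) \<alpha> = DLunit C \<alpha>"
  "\<alpha> \<in> Obj (C1 C) \<Longrightarrow> BRunit (Bicat B) \<alpha> = DRunit C \<alpha>"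
  by (simp_all add: H_star_def horizontal_bicategory_def restrict_bicat_def restrict_cat_def Let_def)

text \<open>Simplification turns \<open>Deco B\<close> into \<open>restrict_cat (C0 C)\<close>;
  these rules take over from there.\<close>

lemma restrict_C0_simps [simp]:
  "Mor (restrict_cat (C0 C)) = Mor (C0 C)"
  "Obj (restrict_cat (C0 C)) = Obj (C0 C)"
  "f \<in> Mor (C0 C) \<Longrightarrow> Dom (restrict_cat (C0 C)) f = Dom (C0 C) f"
  "f \<in> Mor (C0 C) \<Longrightarrow> Cod (restrict_cat (C0 C)) f = Cod (C0 C) f"
  "x \<in> Obj (C0 C) \<Longrightarrow> Id (restrict_cat (C0 C)) x = Id (C0 C) x"
  "\<lbrakk>f \<in> Mor (C0 C); g \<in> Mor (C0 C); Cod (C0 C) f = Dom (C0 C) g\<rbrakk>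
    \<Longrightarrow> Comp (restrict_cat (C0 C)) g f = Comp (C0 C) g f"
  by (simp_all add: restrict_cat_def)

text \<open>Horizontal composability of 2-cells is tested on the ends of their tops, whereas in
  \<open>C\<close> it is equality of edges. For globular squares the two conditions agree.\<close>

lemma H_star_comps:
  "\<lbrakk>\<alpha> \<in> Obj (C1 C); \<beta> \<in> Obj (C1 C); right_ob C \<alpha> = left_ob C \<beta>\<rbrakk>
    \<Longrightarrow> HComp1 (Bicat B) \<beta> \<alpha> = hcomp_ob C \<beta> \<alpha>"
  "\<lbrakk>\<phi> \<in> globular_squares C; \<psi> \<in> globular_squares C; Cod (C1 C) \<phi> = Dom (C1 C) \<psi>\<rbrakk>
    \<Longrightarrow> Comp (Homs (Bicat B)) \<psi> \<phi> = Comp (C1 C) \<psi> \<phi>"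
  "\<lbrakk>\<phi> \<in> globular_squares C; \<psi> \<in> globular_squares C;
     right_ob C (Dom (C1 C) \<phi>) = left_ob C (Dom (C1 C) \<psi>)\<rbrakk>
    \<Longrightarrow> HComp2 (Bicat B) \<psi> \<phi> = hcomp_sq C \<psi> \<phi>"
  "\<lbrakk>\<alpha> \<in> Obj (C1 C); \<beta> \<in> Obj (C1 C); \<gamma> \<in> Obj (C1 C);
     right_ob C \<alpha> = left_ob C \<beta>; right_ob C \<beta> = left_ob C \<gamma>\<rbrakk>
    \<Longrightarrow> BAssoc (Bicat B) \<gamma> \<beta> \<alpha> = DAssoc C \<gamma> \<beta> \<alpha>"
  using globularD(1) Dom_Obj
  by (simp_all add: H_star_def horizontal_bicategory_def restrict_bicat_def restrict_cat_def Let_def)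

section \<open>Soundness of evaluation\<close>

text \<open>The five claims need a common induction: \<open>well_formed\<close> speaks of formal
  boundaries, and only once these are boundaries in \<open>C\<close> do the values compose there. A
  2-cell of \<open>H_star C\<close> is already a square of \<open>C\<close>, so \<open>FCell\<close>
  needs no translation.\<close>

lemma eval_sq_boundary:
  assumes "well_formed B \<Phi>"
  shows "eval_sq C \<Phi> \<in> Mor (C1 C)" "ftop B \<Phi> = Dom (C1 C) (eval_sq C \<Phi>)"
    "fbot B \<Phi> = Cod (C1 C) (eval_sq C \<Phi>)" "fleft B \<Phi> = left_sq C (eval_sq C \<Phi>)"
    "fright B \<Phi> = right_sq C (eval_sq C \<Phi>)"
proof -
  have "eval_sq C \<Phi> \<in> Mor (C1 C) \<and> ftop B \<Phi> = Dom (C1 C) (eval_sq C \<Phi>) \<and>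
    fbot B \<Phi> = Cod (C1 C) (eval_sq C \<Phi>) \<and> fleft B \<Phi> = left_sq C (eval_sq C \<Phi>) \<and>
    fright B \<Phi> = right_sq C (eval_sq C \<Phi>)"
    using assms
  proof (induction \<Phi>)
    case (FCell \<phi>)
    then have g: "\<phi> \<in> globular_squares C" by simp
    note d = globularD[OF g]
    have "Dom (C1 C) \<phi> \<in> Obj (C1 C)" using d(1) Dom_Obj by blast
    then show ?case using g d ends by simp
  next
    case (FHid f)
    then show ?case using C0.Dom_Obj C0.Cod_Obj by (simp add: hid_sq_hom hid_edges)
  next
    case (FV \<Psi> \<Phi>)
    then show ?case
      by (simp add: Comp_Mor edges_Comp left_sq_hom right_sq_hom)
  next
    case (FH \<Psi> \<Phi>)
    then have m: "eval_sq C \<Psi> \<in> Mor (C1 C)" "eval_sq C \<Phi> \<in> Mor (C1 C)"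
      "right_sq C (eval_sq C \<Phi>) = left_sq C (eval_sq C \<Psi>)" by auto
    \<comment> \<open>The ends of top and bottom are domain and codomain of the edges. Equal edges
      therefore make both tops and bottoms composable, and \<open>HComp1\<close> takes its intended
      value on them.\<close>
    then have "right_ob C (Dom (C1 C) (eval_sq C \<Phi>)) = left_ob C (Dom (C1 C) (eval_sq C \<Psi>))"
      "right_ob C (Cod (C1 C) (eval_sq C \<Phi>)) = left_ob C (Cod (C1 C) (eval_sq C \<Psi>))"
      using left_sq_hom right_sq_hom by metis+
    then show ?case
      using FH m by (simp add: hcomp_sq_hom hcomp_edges H_star_comps Dom_Obj Cod_Obj)
  qed
  then show "eval_sq C \<Phi> \<in> Mor (C1 C)" "ftop B \<Phi> = Dom (C1 C) (eval_sq C \<Phi>)"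
    "fbot B \<Phi> = Cod (C1 C) (eval_sq C \<Phi>)" "fleft B \<Phi> = left_sq C (eval_sq C \<Phi>)"
    "fright B \<Phi> = right_sq C (eval_sq C \<Phi>)" by blast+
qed

lemma eval_sq_FV:
  assumes "well_formed B (FV \<Psi> \<Phi>)"
  shows "Cod (C1 C) (eval_sq C \<Phi>) = Dom (C1 C) (eval_sq C \<Psi>)"
  using assms eval_sq_boundary by auto

text \<open>Equality of edges serves the composition in \<open>C\<close>; the equalities between
  ends of 1-cells are the form that \<open>H_star_comps\<close> and the associator axioms ask
  for.\<close>

lemma eval_sq_FH:
  assumes "well_formed B (FH \<Psi> \<Phi>)"
  shows "right_sq C (eval_sq C \<Phi>) = left_sq C (eval_sq C \<Psi>)"
    "right_ob C (Dom (C1 C) (eval_sq C \<Phi>)) = left_ob C (Dom (C1 C) (eval_sq C \<Psi>))"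
    "right_ob C (Cod (C1 C) (eval_sq C \<Phi>)) = left_ob C (Cod (C1 C) (eval_sq C \<Psi>))"
proof -
  show e: "right_sq C (eval_sq C \<Phi>) = left_sq C (eval_sq C \<Psi>)"
    using assms eval_sq_boundary by auto
  have "eval_sq C \<Phi> \<in> Mor (C1 C)" "eval_sq C \<Psi> \<in> Mor (C1 C)"
    using assms eval_sq_boundary by auto
  then show "right_ob C (Dom (C1 C) (eval_sq C \<Phi>)) = left_ob C (Dom (C1 C) (eval_sq C \<Psi>))"
    "right_ob C (Cod (C1 C) (eval_sq C \<Phi>)) = left_ob C (Cod (C1 C) (eval_sq C \<Psi>))"
    using e left_sq_hom right_sq_hom by metis+
qed

text \<open>Each relation imposed on formal squares is an axiom of \<open>C\<close> or a consequence
  of functoriality there. Well-formedness is carried along because values and boundaries are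
  controlled only for well-formed expressions.\<close>

lemma fequiv_eval_sq:
  assumes "(\<Phi>, \<Psi>) \<in> fequiv B"
  shows "well_formed B \<Phi> \<and> well_formed B \<Psi> \<and> eval_sq C \<Phi> = eval_sq C \<Psi>"
  using assms
proof (induction rule: fequiv.induct)
  case (hid_id x)
  then show ?case using unit_ends C0.Id_Mor by (simp add: hid_sq_Id Id_globular)
next
  case (FV_assoc \<Psi> \<Phi> \<Theta>)
  then have "eval_sq C \<Phi> \<in> Mor (C1 C)" "eval_sq C \<Psi> \<in> Mor (C1 C)" "eval_sq C \<Theta> \<in> Mor (C1 C)"
    using eval_sq_boundary(1) by auto
  then show ?case
    using FV_assoc eval_sq_FV[OF FV_assoc(1)] eval_sq_FV[OF FV_assoc(2)] by (simp add: Comp_assoc)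
next
  case (FV_id_top \<Phi>)
  note b = eval_sq_boundary[OF FV_id_top]
  show ?case
    using FV_id_top b Dom_Obj[OF b(1)] Id_Mor[OF Dom_Obj[OF b(1)]] by (simp add: Id_globular Comp_Id_right)
next
  case (FV_id_bot \<Phi>)
  note b = eval_sq_boundary[OF FV_id_bot]
  show ?case
    using FV_id_bot b Cod_Obj[OF b(1)] Id_Mor[OF Cod_Obj[OF b(1)]] by (simp add: Id_globular Comp_Id_left)
next
  case (interchange \<Psi>2 \<Psi>1 \<Phi>2 \<Phi>1)
  then have w: "well_formed B (FV \<Psi>2 \<Psi>1)" "well_formed B (FV \<Phi>2 \<Phi>1)"
    "well_formed B (FH \<Psi>2 \<Phi>2)" "well_formed B (FH \<Psi>1 \<Phi>1)" by simp_all
  then have "eval_sq C \<Phi>1 \<in> Mor (C1 C)" "eval_sq C \<Phi>2 \<in> Mor (C1 C)"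
    "eval_sq C \<Psi>1 \<in> Mor (C1 C)" "eval_sq C \<Psi>2 \<in> Mor (C1 C)"
    using eval_sq_boundary(1) by simp_all
  then show ?case
    using interchange eval_sq_FV[OF w(1)] eval_sq_FV[OF w(2)] eval_sq_FH(1)[OF w(3)]
      eval_sq_FH(1)[OF w(4)] by (simp add: hcomp_sq_interchange)
next
  case (FCell_vcomp \<psi> \<phi>)
  then show ?case using eval_sq_FV[OF FCell_vcomp] by (simp add: globular_Comp H_star_comps)
next
  case (FHid_vcomp f g)
  then show ?case by (simp add: hid_sq_Comp C0.Comp_Mor C0.Dom_Obj C0.Cod_Obj)
next
  case (FCell_hcomp \<psi> \<phi>)
  then have "\<phi> \<in> globular_squares C" "\<psi> \<in> globular_squares C" by simp_all
  then show ?case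
    using FCell_hcomp eval_sq_FH[OF FCell_hcomp]
    by (simp add: globular_hcomp H_star_comps del: fleft.simps fright.simps)
next
  case (lunit_natural \<Phi>)
  note b = eval_sq_boundary[OF lunit_natural]
  let ?a = "Dom (C1 C) (eval_sq C \<Phi>)" and ?b = "Cod (C1 C) (eval_sq C \<Phi>)"
  have o: "?a \<in> Obj (C1 C)" "?b \<in> Obj (C1 C)" using b Dom_Obj Cod_Obj by blast+
  have g: "DLunit C ?a \<in> globular_squares C" "DLunit C ?b \<in> globular_squares C"
    using o DLunit_globular by blast+
  \<comment> \<open>Once this composite is known to be well-formed, its bottom can be computed in
    \<open>C\<close>, where it is the domain of the unitor at \<open>?b\<close>.\<close>
  have h: "well_formed B (FH (FHid (fright B \<Phi>)) \<Phi>)"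
    using lunit_natural b right_sq_hom by simp
  show ?case
    using h lunit_natural b o g DLunit_natural[of "eval_sq C \<Phi>" ?a ?b] lunit_iso
      eval_sq_boundary[OF h] right_sq_hom[OF b(1)] ends
    by (auto simp: hom_set_def hcomp_sq_hom hid_sq_hom hid_edges)
next
  case (runit_natural \<Phi>)
  note b = eval_sq_boundary[OF runit_natural]
  let ?a = "Dom (C1 C) (eval_sq C \<Phi>)" and ?b = "Cod (C1 C) (eval_sq C \<Phi>)"
  have o: "?a \<in> Obj (C1 C)" "?b \<in> Obj (C1 C)" using b Dom_Obj Cod_Obj by blast+
  have g: "DRunit C ?a \<in> globular_squares C" "DRunit C ?b \<in> globular_squares C"
    using o DRunit_globular by blast+
  have h: "well_formed B (FH \<Phi> (FHid (fleft B \<Phi>)))"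
    using runit_natural b left_sq_hom by simp
  show ?case
    using h runit_natural b o g DRunit_natural[of "eval_sq C \<Phi>" ?a ?b] runit_iso
      eval_sq_boundary[OF h] left_sq_hom[OF b(1)] ends
    by (auto simp: hom_set_def hcomp_sq_hom hid_sq_hom hid_edges)
next
  case (assoc_natural \<Phi>2 \<Phi>1 \<Phi>3)
  let ?e = "eval_sq C" and ?D = "Dom (C1 C)" and ?C = "Cod (C1 C)"
  have w: "well_formed B \<Phi>1" "well_formed B \<Phi>2" "well_formed B \<Phi>3" using assoc_natural by auto
  note b = eval_sq_boundary[OF w(1)] eval_sq_boundary[OF w(2)] eval_sq_boundary[OF w(3)]
  note e = eval_sq_FH[OF assoc_natural(1)] eval_sq_FH[OF assoc_natural(2)]
  have o: "?D (?e \<Phi>1) \<in> Obj (C1 C)" "?D (?e \<Phi>2) \<in> Obj (C1 C)" "?D (?e \<Phi>3) \<in> Obj (C1 C)"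
    "?C (?e \<Phi>1) \<in> Obj (C1 C)" "?C (?e \<Phi>2) \<in> Obj (C1 C)" "?C (?e \<Phi>3) \<in> Obj (C1 C)"
    using b Dom_Obj Cod_Obj by blast+
  \<comment> \<open>In \<open>e\<close>, items 2 and 5 are composability of the tops, items 3 and 6
    that of the bottoms.\<close>
  note g = DAssoc_globular[OF o(1-3) e(2,5)] DAssoc_globular[OF o(4-6) e(3,6)]
  note i = assoc_iso[OF o(1-3) e(2,5)] assoc_iso[OF o(4-6) e(3,6)]
  have h: "well_formed B (FH (FH \<Phi>3 \<Phi>2) \<Phi>1)" "well_formed B (FH \<Phi>3 (FH \<Phi>2 \<Phi>1))"
    using assoc_natural by simp_all
  have n: "Comp (C1 C) (DAssoc C (?C (?e \<Phi>3)) (?C (?e \<Phi>2)) (?C (?e \<Phi>1)))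
        (hcomp_sq C (hcomp_sq C (?e \<Phi>3) (?e \<Phi>2)) (?e \<Phi>1)) =
      Comp (C1 C) (hcomp_sq C (?e \<Phi>3) (hcomp_sq C (?e \<Phi>2) (?e \<Phi>1)))
        (DAssoc C (?D (?e \<Phi>3)) (?D (?e \<Phi>2)) (?D (?e \<Phi>1)))"
    by (rule DAssoc_natural) (use b e in \<open>auto simp: hom_set_def\<close>)
  \<comment> \<open>These are the two matchings that make the vertical composites with the
    associators well-formed. The final simplification keeps \<open>ftop\<close> and
    \<open>fbot\<close> of horizontal composites folded so that they apply.\<close>
  have "fbot B (FH (FH \<Phi>3 \<Phi>2) \<Phi>1) = ?D (DAssoc C (?C (?e \<Phi>3)) (?C (?e \<Phi>2)) (?C (?e \<Phi>1)))"
    "ftop B (FH \<Phi>3 (FH \<Phi>2 \<Phi>1)) = ?C (DAssoc C (?D (?e \<Phi>3)) (?D (?e \<Phi>2)) (?D (?e \<Phi>1)))"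
    unfolding eval_sq_boundary[OF h(1)] eval_sq_boundary[OF h(2)]
    using i b e by (auto simp: hom_set_def hcomp_sq_hom hcomp_edges)
  then show ?case
    using h n b(2,3,7,8,12,13) e g o
    by (simp add: H_star_comps del: ftop.simps(4) fbot.simps(4))
qed auto

section \<open>Calculus of classes in \<open>Q B\<close>\<close>

text \<open>The boundary of a well-formed expression is that of its value, and equivalent
  expressions have the same value. This is what makes the uses of \<open>the_elem\<close> in
  \<open>Q\<close> meaningful.\<close>

lemma fequiv_boundary:
  assumes "(\<Phi>, \<Psi>) \<in> fequiv B"
  shows "ftop B \<Psi> = ftop B \<Phi>" "fbot B \<Psi> = fbot B \<Phi>"
    "fleft B \<Psi> = fleft B \<Phi>" "fright B \<Psi> = fright B \<Phi>"
  using fequiv_eval_sq[OF assms] eval_sq_boundary by simp_all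

lemma equiv_fequiv: "equiv {\<Phi>. well_formed B \<Phi>} (fequiv B)"
  by (rule equivI)
    (auto simp: refl_on_def sym_def trans_def dest: fequiv_eval_sq
      intro: fequiv.refl fequiv.sym fequiv.trans)

lemma fclass_eq: "(\<Phi>, \<Psi>) \<in> fequiv B \<Longrightarrow> fclass B \<Phi> = fclass B \<Psi>"
  using equiv_class_eq[OF equiv_fequiv] by (simp add: fclass_def)

lemma fclass_self: "well_formed B \<Phi> \<Longrightarrow> \<Phi> \<in> fclass B \<Phi>"
  by (simp add: fclass_def fequiv.refl)

lemma the_elem_fclass:
  assumes "well_formed B \<Phi>" "\<And>\<Psi>. (\<Phi>, \<Psi>) \<in> fequiv B \<Longrightarrow> h \<Psi> = h \<Phi>"
  shows "the_elem (h ` fclass B \<Phi>) = h \<Phi>"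
proof (rule the_elem_image_unique)
  show "fclass B \<Phi> \<noteq> {}"
    using fclass_self[OF assms(1)] by blast
  show "h \<Psi> = h \<Phi>" if "\<Psi> \<in> fclass B \<Phi>" for \<Psi>
    by (rule assms(2)) (use that in \<open>simp add: fclass_def\<close>)
qed

lemma Q_boundary:
  assumes "well_formed B \<Phi>"
  shows "Dom (C1 (Q B)) (fclass B \<Phi>) = ftop B \<Phi>" "Cod (C1 (Q B)) (fclass B \<Phi>) = fbot B \<Phi>"
    "left_sq (Q B) (fclass B \<Phi>) = fleft B \<Phi>" "right_sq (Q B) (fclass B \<Phi>) = fright B \<Phi>"
  by (simp_all add: Q_def the_elem_fclass[OF assms fequiv_boundary(1)]
      the_elem_fclass[OF assms fequiv_boundary(2)] the_elem_fclass[OF assms fequiv_boundary(3)]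
      the_elem_fclass[OF assms fequiv_boundary(4)])

text \<open>The union in the definition of \<open>Q\<close> runs over nonempty index sets, and by
  congruence all its members are the same class.\<close>

lemma Q_Comp:
  assumes "well_formed B (FV \<Psi> \<Phi>)"
  shows "Comp (C1 (Q B)) (fclass B \<Psi>) (fclass B \<Phi>) = fclass B (FV \<Psi> \<Phi>)"
proof -
  have "fclass B (FV \<Psi>' \<Phi>') = fclass B (FV \<Psi> \<Phi>)"
    if "\<Psi>' \<in> fclass B \<Psi>" "\<Phi>' \<in> fclass B \<Phi>" for \<Psi>' \<Phi>'
  proof (rule fclass_eq[symmetric], rule fequiv.FV_cong)
    show e: "(\<Phi>, \<Phi>') \<in> fequiv B" "(\<Psi>, \<Psi>') \<in> fequiv B" using that by (auto simp: fclass_def)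
    \<comment> \<open>Boundaries are constant on classes, so other representatives compose as
      well.\<close>
    show "well_formed B (FV \<Psi>' \<Phi>')"
      using assms fequiv_eval_sq[OF e(1)] fequiv_eval_sq[OF e(2)] fequiv_boundary[OF e(1)]
        fequiv_boundary[OF e(2)] by simp
  qed (fact assms)
  then have "(\<Union>\<Psi>'\<in>fclass B \<Psi>. \<Union>\<Phi>'\<in>fclass B \<Phi>. fclass B (FV \<Psi>' \<Phi>')) = fclass B (FV \<Psi> \<Phi>)"
    using assms fclass_self[of \<Phi>] fclass_self[of \<Psi>] unfolding well_formed.simps
    by (intro SUP_eq_const) blast+
  then show ?thesis by (simp add: Q_def)
qed

lemma Q_hcomp:
  assumes "well_formed B (FH \<Psi> \<Phi>)"
  shows "hcomp_sq (Q B) (fclass B \<Psi>) (fclass B \<Phi>) = fclass B (FH \<Psi> \<Phi>)"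
proof -
  have "fclass B (FH \<Psi>' \<Phi>') = fclass B (FH \<Psi> \<Phi>)"
    if "\<Psi>' \<in> fclass B \<Psi>" "\<Phi>' \<in> fclass B \<Phi>" for \<Psi>' \<Phi>'
  proof (rule fclass_eq[symmetric], rule fequiv.FH_cong)
    show e: "(\<Phi>, \<Phi>') \<in> fequiv B" "(\<Psi>, \<Psi>') \<in> fequiv B" using that by (auto simp: fclass_def)
    show "well_formed B (FH \<Psi>' \<Phi>')"
      using assms fequiv_eval_sq[OF e(1)] fequiv_eval_sq[OF e(2)] fequiv_boundary[OF e(1)]
        fequiv_boundary[OF e(2)] by simp
  qed (fact assms)
  then have "(\<Union>\<Psi>'\<in>fclass B \<Psi>. \<Union>\<Phi>'\<in>fclass B \<Phi>. fclass B (FH \<Psi>' \<Phi>')) = fclass B (FH \<Psi> \<Phi>)"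
    using assms fclass_self[of \<Phi>] fclass_self[of \<Psi>] unfolding well_formed.simps
    by (intro SUP_eq_const) blast+
  then show ?thesis by (simp add: Q_def)
qed

lemma Q_simps:
  "C0 (Q B) = restrict_cat (C0 C)" "hid_sq (Q B) f = fclass B (FHid f)"
  "Id (C1 (Q B)) \<alpha> = fclass B (FCell (Id (Homs (Bicat B)) \<alpha>))"
  by (simp_all add: Q_def)

lemma Q_Mor: "\<Xi> \<in> Mor (C1 (Q B)) \<longleftrightarrow> (\<exists>\<Phi>. well_formed B \<Phi> \<and> \<Xi> = fclass B \<Phi>)"
  by (auto simp: Q_def quotient_def fclass_def)

lemma restrict_C0_Id: "Id (restrict_cat (C0 C)) ` Obj (C0 C) = Id (C0 C) ` Obj (C0 C)"
  by (rule image_cong) simp_all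

section \<open>Generation of \<open>Q B\<close>, and evaluation onto \<open>gamma C\<close>\<close>

text \<open>Globularity is a condition on the two edges alone, and evaluation preserves
  edges.\<close>

lemma fclass_globular_iff:
  assumes "well_formed B \<Phi>"
  shows "fclass B \<Phi> \<in> globular_squares (Q B) \<longleftrightarrow> eval_sq C \<Phi> \<in> globular_squares C"
  using assms eval_sq_boundary[OF assms]
  by (auto simp: globular_squares_def Q_Mor Q_boundary Q_simps restrict_C0_Id)

text \<open>\<open>Q B\<close> is globularly generated: the constructors of formal squares
  correspond to the generators and operations of \<open>gamma_squares\<close>.\<close>

lemma fclass_gamma_squares: "well_formed B \<Phi> \<Longrightarrow> fclass B \<Phi> \<in> gamma_squares (Q B)"
proof (induction \<Phi>)
  case (FCell \<phi>)
  then show ?case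
    using fclass_globular_iff[OF FCell] by (intro gamma_squares.gen) (simp add: generating_squares_def)
next
  case (FHid f)
  \<comment> \<open>The class of \<open>FHid f\<close> is folded back into
    \<open>hid_sq (Q B) f\<close> to exhibit it in the image of \<open>hid_sq (Q B)\<close>.\<close>
  then show ?case
    by (intro gamma_squares.gen) (simp add: generating_squares_def Q_simps flip: Q_simps(2))
next
  case (FV \<Psi> \<Phi>)
  then show ?case
    using gamma_squares.vcomp[of "fclass B \<Phi>" "Q B" "fclass B \<Psi>"] by (simp add: Q_boundary Q_Comp)
next
  case (FH \<Psi> \<Phi>)
  then show ?case
    using gamma_squares.hcomp[of "fclass B \<Phi>" "Q B" "fclass B \<Psi>"] by (simp add: Q_boundary Q_hcomp)
qed

text \<open>A derivation of a square from the generators is itself a formal square with that value,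
  so evaluation reaches all of \<open>gamma C\<close>.\<close>

lemma gamma_squares_eval_sq:
  assumes "\<Phi> \<in> gamma_squares C"
  obtains \<Xi> where "well_formed B \<Xi>" "eval_sq C \<Xi> = \<Phi>"
proof -
  have "\<exists>\<Xi>. well_formed B \<Xi> \<and> eval_sq C \<Xi> = \<Phi>"
    using assms
  proof (induction rule: gamma_squares.induct)
    case (gen \<Phi>)
    then consider "\<Phi> \<in> globular_squares C" | f where "f \<in> Mor (C0 C)" "\<Phi> = hid_sq C f"
      by (auto simp: generating_squares_def)
    then show ?case
    proof cases
      case 1
      then show ?thesis by (intro exI[of _ "FCell \<Phi>"]) simp
    next
      case (2 f)
      then show ?thesis by (intro exI[of _ "FHid f"]) simp
    qed
  next
    case (vcomp \<Phi> \<Psi>)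
    then obtain \<Xi> \<Xi>' where "well_formed B \<Xi>" "eval_sq C \<Xi> = \<Phi>" "well_formed B \<Xi>'" "eval_sq C \<Xi>' = \<Psi>"
      by blast
    then show ?case using vcomp(3) eval_sq_boundary by (intro exI[of _ "FV \<Xi>' \<Xi>"]) simp
  next
    case (hcomp \<Phi> \<Psi>)
    then obtain \<Xi> \<Xi>' where "well_formed B \<Xi>" "eval_sq C \<Xi> = \<Phi>" "well_formed B \<Xi>'" "eval_sq C \<Xi>' = \<Psi>"
      by blast
    then show ?case using hcomp(3) eval_sq_boundary by (intro exI[of _ "FH \<Xi>' \<Xi>"]) simp
  qed
  then show ?thesis using that by blast
qed

section \<open>Evaluation and the filtration by length\<close>

text \<open>This expresses that the double functor induced by evaluation sends the class into
  \<open>X\<close>, without choosing a function on classes. One representative suffices because the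
  value is constant on a class.\<close>

definition evaluates_into :: "'s set \<Rightarrow> ('v, 's) formal_sq set \<Rightarrow> bool" where
  "evaluates_into X \<Xi> \<longleftrightarrow> (\<exists>\<Phi>. well_formed B \<Phi> \<and> \<Xi> = fclass B \<Phi> \<and> eval_sq C \<Phi> \<in> X)"

lemma evaluates_into_fclass:
  assumes "well_formed B \<Phi>" "evaluates_into X (fclass B \<Phi>)"
  shows "eval_sq C \<Phi> \<in> X"
proof -
  obtain \<Psi> where "eval_sq C \<Psi> \<in> X" "(\<Psi>, \<Phi>) \<in> fequiv B"
    using assms fclass_self by (auto simp: evaluates_into_def fclass_def)
  then show ?thesis using fequiv_eval_sq by auto
qed

text \<open>Horizontal composites of classes are represented by \<open>FH\<close> of
  representatives, and evaluation turns \<open>FH\<close> into \<open>hcomp_sq C\<close>.\<close>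

lemma horizontal_composites_evaluates_into:
  assumes "\<Xi> \<in> horizontal_composites (gamma (Q B)) Y" "\<And>\<Xi>. \<Xi> \<in> Y \<Longrightarrow> evaluates_into X \<Xi>"
  shows "evaluates_into (horizontal_composites (gamma C) X) \<Xi>"
  using assms(1)
proof (induction rule: horizontal_composites.induct)
  case (base \<Xi>)
  then show ?case
    using assms(2)[of \<Xi>] by (auto simp: evaluates_into_def intro: horizontal_composites.base)
next
  case (hcomp \<Xi> \<Xi>')
  then obtain \<Phi> \<Psi> where w: "well_formed B \<Phi>" "\<Xi> = fclass B \<Phi>" "well_formed B \<Psi>" "\<Xi>' = fclass B \<Psi>"
    and m: "eval_sq C \<Phi> \<in> horizontal_composites (gamma C) X"
      "eval_sq C \<Psi> \<in> horizontal_composites (gamma C) X"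
    by (auto simp: evaluates_into_def)
  have h: "well_formed B (FH \<Psi> \<Phi>)" using w hcomp(3) by (simp add: Q_boundary)
  then show ?case
    using w Q_hcomp[OF h] horizontal_composites.hcomp[OF m] eval_sq_FH[OF h]
    unfolding evaluates_into_def by (intro exI[of _ "FH \<Psi> \<Phi>"]) simp
qed

lemma generated_subcategory_evaluates_into:
  assumes "\<Xi> \<in> generated_subcategory (C1 (gamma (Q B))) Y" "\<And>\<Xi>. \<Xi> \<in> Y \<Longrightarrow> evaluates_into X \<Xi>"
  shows "evaluates_into (generated_subcategory (C1 (gamma C)) X) \<Xi>"
  using assms(1)
proof (induction rule: generated_subcategory.induct)
  case (base \<Xi>)
  then show ?case
    using assms(2)[of \<Xi>] by (auto simp: evaluates_into_def intro: generated_subcategory.base)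
next
  case (id_dom \<Xi>)
  then obtain \<Phi> where w: "well_formed B \<Phi>" "\<Xi> = fclass B \<Phi>" "eval_sq C \<Phi> \<in> X"
    using assms(2) by (auto simp: evaluates_into_def)
  note b = eval_sq_boundary[OF w(1)]
  \<comment> \<open>The formal identity 2-cell at the top represents the identity in
    \<open>Q B\<close> and evaluates to the identity in \<open>C\<close>.\<close>
  show ?case
    using w b Dom_Obj[OF b(1)] generated_subcategory.id_dom[OF w(3), of "C1 (gamma C)"]
    unfolding evaluates_into_def
    by (intro exI[of _ "FCell (Id (Homs (Bicat B)) (ftop B \<Phi>))"])
      (simp add: Q_simps Q_boundary Id_globular)
next
  case (id_cod \<Xi>)
  then obtain \<Phi> where w: "well_formed B \<Phi>" "\<Xi> = fclass B \<Phi>" "eval_sq C \<Phi> \<in> X"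
    using assms(2) by (auto simp: evaluates_into_def)
  note b = eval_sq_boundary[OF w(1)]
  show ?case
    using w b Cod_Obj[OF b(1)] generated_subcategory.id_cod[OF w(3), of "C1 (gamma C)"]
    unfolding evaluates_into_def
    by (intro exI[of _ "FCell (Id (Homs (Bicat B)) (fbot B \<Phi>))"])
      (simp add: Q_simps Q_boundary Id_globular)
next
  case (comp \<Xi> \<Xi>')
  then obtain \<Phi> \<Psi> where w: "well_formed B \<Phi>" "\<Xi> = fclass B \<Phi>" "well_formed B \<Psi>" "\<Xi>' = fclass B \<Psi>"
    and m: "eval_sq C \<Phi> \<in> generated_subcategory (C1 (gamma C)) X"
      "eval_sq C \<Psi> \<in> generated_subcategory (C1 (gamma C)) X"
    by (auto simp: evaluates_into_def)
  have h: "well_formed B (FV \<Psi> \<Phi>)" using w comp(3) by (simp add: Q_boundary)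
  then show ?case
    using w Q_Comp[OF h] generated_subcategory.comp[OF m] eval_sq_FV[OF h]
    unfolding evaluates_into_def by (intro exI[of _ "FV \<Psi> \<Phi>"]) simp
qed

text \<open>\<open>Q B\<close> is not interpreted as a \<open>double_category\<close> here, so the
  counterpart of \<open>gamma_squares_Mor\<close> is obtained directly, by composing
  representatives.\<close>

lemma gamma_squares_Q: "\<Xi> \<in> gamma_squares (Q B) \<Longrightarrow> \<exists>\<Phi>. well_formed B \<Phi> \<and> \<Xi> = fclass B \<Phi>"
proof (induction rule: gamma_squares.induct)
  case (gen \<Xi>)
  then show ?case
    by (auto simp: generating_squares_def globular_squares_def Q_Mor Q_simps
        intro: exI[of _ "FHid _"])
next
  case (vcomp \<Xi> \<Xi>')
  then obtain \<Phi> \<Psi> where w: "well_formed B \<Phi>" "\<Xi> = fclass B \<Phi>" "well_formed B \<Psi>" "\<Xi>' = fclass B \<Psi>"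
    by blast
  then have "well_formed B (FV \<Psi> \<Phi>)" using vcomp(3) by (simp add: Q_boundary)
  then show ?case using w Q_Comp by blast
next
  case (hcomp \<Xi> \<Xi>')
  then obtain \<Phi> \<Psi> where w: "well_formed B \<Phi>" "\<Xi> = fclass B \<Phi>" "well_formed B \<Psi>" "\<Xi>' = fclass B \<Psi>"
    by blast
  then have "well_formed B (FH \<Psi> \<Phi>)" using hcomp(3) by (simp add: Q_boundary)
  then show ?case using w Q_hcomp by blast
qed

text \<open>Evaluation respects generators, both compositions and identities, so it preserves each
  stage with the same index. The induction can start at the auxiliary stage \<open>0\<close>, the
  generators.\<close>

lemma V_squares_evaluates_into:
  "\<Xi> \<in> V_squares (gamma (Q B)) k \<Longrightarrow> evaluates_into (V_squares (gamma C) k) \<Xi>"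
proof (induction k arbitrary: \<Xi>)
  case 0
  then consider "\<Xi> \<in> globular_squares (gamma (Q B))"
    | f where "f \<in> Mor (C0 C)" "\<Xi> = fclass B (FHid f)"
    by (auto simp: generating_squares_def Q_simps)
  then show ?case
  proof cases
    case 1
    \<comment> \<open>Globularity is moved from \<open>gamma (Q B)\<close> to \<open>Q B\<close>,
      through evaluation to \<open>C\<close>, and from there to \<open>gamma C\<close>.\<close>
    then have q: "\<Xi> \<in> globular_squares (Q B)" "\<Xi> \<in> gamma_squares (Q B)"
      using gamma_squares_Q Q_Mor by (auto simp: globular_squares_def)
    then obtain \<Phi> where w: "well_formed B \<Phi>" "\<Xi> = fclass B \<Phi>"
      using gamma_squares_Q by blast
    then have "eval_sq C \<Phi> \<in> globular_squares (gamma C)"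
      using q fclass_globular_iff globular_squares_gamma[OF gamma_squares_Mor] by simp
    then show ?thesis
      using w by (auto simp: evaluates_into_def generating_squares_def)
  next
    case (2 f)
    then show ?thesis
      unfolding evaluates_into_def
      by (intro exI[of _ "FHid f"]) (simp add: generating_squares_def)
  qed
next
  case (Suc k)
  show ?case
    unfolding V_squares.simps
    by (rule generated_subcategory_evaluates_into[OF Suc.prems[unfolded V_squares.simps]])
      (rule horizontal_composites_evaluates_into[OF _ Suc.IH])
qed

section \<open>Comparison of the lengths\<close>

lemma double_length_le_H_star: "double_length C \<le> decorated_bicat_length B"
  unfolding double_length_def decorated_bicat_length_def
proof (rule globularly_generated_length_mono)
  fix k
  assume k: "V_squares (gamma (Q B)) k = Mor (C1 (gamma (Q B)))"
  have "\<Phi> \<in> V_squares (gamma C) k" if "\<Phi> \<in> gamma_squares C" for \<Phi>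
  proof -
    \<comment> \<open>The square is lifted to a formal one. Its class lies in stage \<open>k\<close>
      by assumption \<open>k\<close>, and evaluation brings it back to the original square, now in
      stage \<open>k\<close> of \<open>gamma C\<close>.\<close>
    obtain \<Xi> where x: "well_formed B \<Xi>" "eval_sq C \<Xi> = \<Phi>"
      using gamma_squares_eval_sq \<open>\<Phi> \<in> gamma_squares C\<close> by blast
    then have "fclass B \<Xi> \<in> V_squares (gamma (Q B)) k"
      using k fclass_gamma_squares by simp
    then show ?thesis
      using x V_squares_evaluates_into evaluates_into_fclass by blast
  qed
  then show "V_squares (gamma C) k = Mor (C1 (gamma C))"
    using V_squares_gamma by auto
qed

end

theorem proposition3p1:
  fixes B :: "('o, 'v, 'h, 's) decorated_bicat"
    and C :: "('o, 'v, 'h, 's) double_cat"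
  assumes "decorated_bicategory B"
    and "double_category C"
    and "H_star C = B"
  shows "double_length C \<le> decorated_bicat_length B"
  using double_category.double_length_le_H_star[OF assms(2)] assms(3) by simp

end
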